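(* With the setting and the algorithm APAPC (for $g=0$) as in the context, call $(x^\star,u^\star)\in\mathcal{X}\times\mathcal{U}$ a saddle-point solution if $0=\nabla f(x^\star)+K^*u^\star$ and $Kx^\star\in\partial h^*(u^\star)$. Assume that: (i) $a_t\to\infty$ and $\sum_{t\ge1}\frac1{a_t}=\infty$. (ii) The solution $u^\star$ of the dual problem $\min_{u\in\mathcal{U}} f^*(-K^*u)+h^*(u)$ is unique, and $\|v^t-u^\star\|\to0$. (iii) The sequence $(z^t)_{t\ge0}$ is bounded. (iv) $\mathcal{G}_{x^\star,u^\star}(x^t,u^t)\to0$ for every saddle-point solution $(x^\star,u^\star)$. (v) $\|Kz^t-\tilde\nabla h^*(v^t)\|\to0$. Then: (a) $\|u^t-u^\star\|\to0$ and $\|y^t-x^t\|=\mathcal{O}(1/a_t)$. (b) For every saddle-point solution $(x^\star,u^\star)$ and every $t\ge0$, $\|\nabla f(x^t)+K^*u^\star\|^2\le2L_f\,\mathcal{G}_{x^\star,u^\star}(x^t,u^t)$, and the right-hand side tends to $0$. (c) The sequence $(x^t)_{t\ge0}$ is bounded, and all its weak cluster points are solutions of $\min_{x\in\mathcal{X}} f(x)+h(Kx)$. (d) Every weak cluster point $z^\infty$ of $(z^t)_{t\ge0}$ satisfies $Kz^\infty\in\partial h^*(u^\star)$. In addition, assume the following: (vi) For every saddle-point solution $(x^\star,u^\star)$ there exists a Lyapunov function $\mathcal{E}^t_{x^\star}:=\frac{1}{2\gamma}\|z^t-x^\star\|^2+a_t^2\,\mathcal{G}_{x^\star,u^\star}(x^t,u^t)+\mathcal{R}^t$,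 for some dual term $\mathcal{R}^t\ge0$ that does not depend on $x^\star$ (so the same sequence $(\mathcal{R}^t)_{t\ge0}$ serves for all $x^\star$). Moreover, $(\mathcal{E}^t_{x^\star})_{t\ge0}$ is nonincreasing. (vii) For any pair of saddle-point solutions $(\hat x^\star,u^\star)$ and $(\check x^\star,u^\star)$, $K\hat x^\star=K\check x^\star$. Then there exists a solution $x^\star$ of $\min_{x\in\mathcal{X}}f(x)+h(Kx)$ such that $(x^t)_{t\ge0}$ and $(y^t)_{t\ge0}$ both converge weakly to $x^\star$.
   Context: Setting: $\mathcal{X},\mathcal{U}$ are real Hilbert spaces; $f:\mathcal{X}\to\mathbb{R}$ is convex, differentiable and $L_f$-smooth ($\nabla f$ is $L_f$-Lipschitz), $L_f>0$; $h:\mathcal{U}\to\mathbb{R}\cup\{+\infty\}$ is proper, lower semicontinuous, convex; $K:\mathcal{X}\to\mathcal{U}$ is a nonzero bounded linear operator with adjoint $K^*$; $\phi^*$ denotes the convex conjugate of $\phi$. The primal problem is $\min_x f(x)+h(Kx)$. It is assumed throughout that at least one saddle-point solution exists. $\mathrm{prox}_\phi(u):=\arg\min_{w}\{\phi(w)+\frac12\|w-u\|^2\}$. Lagrangian: $\mathcal{L}(x,u):=f(x)+\langle Kx,u\rangle-h^*(u)$. Lagrangian gap: $\mathcal{G}_{x^\star,u^\star}(x,u):=\mathcal{L}(x,u^\star)-\mathcal{L}(x^\star,u)\in[0,+\infty]$. APAPC with $g=0$: given $\gamma>0$, $\tau>0$, a real sequence $(a_t)_{t\ge0}$ with $a_0\ge0$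 and $a_t\ge1$ for all $t\ge1$, $x^0=z^0\in\mathcal{X}$, $u^0=v^0\in\mathcal{U}$, iterate for $t\ge0$: $y^t:=(1-\frac1{a_{t+1}})x^t+\frac1{a_{t+1}}z^t$; $\hat z^t:=z^t-a_{t+1}\gamma\nabla f(y^t)-a_{t+1}\gamma K^*v^t$; $v^{t+1}:=\mathrm{prox}_{\frac{\tau}{a_{t+1}}h^*}\big(v^t+\frac{\tau}{a_{t+1}}K\hat z^t\big)$; $z^{t+1}:=z^t-a_{t+1}\gamma\nabla f(y^t)-a_{t+1}\gamma K^*v^{t+1}$; $x^{t+1}:=(1-\frac1{a_{t+1}})x^t+\frac1{a_{t+1}}z^{t+1}$; $u^{t+1}:=(1-\frac1{a_{t+1}})u^t+\frac1{a_{t+1}}v^{t+1}$. For $t\ge0$, $\tilde\nabla h^*(v^{t+1})\in\partial h^*(v^{t+1})$ denotes the subgradient satisfying $v^{t+1}+\frac{\tau}{a_{t+1}}\tilde\nabla h^*(v^{t+1})=v^t+\frac{\tau}{a_{t+1}}K\hat z^t$. Convention: $0\cdot(+\infty)=0$.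
   Formalization: In (a), the rate ‖y^t − x^t‖ = O(1/a_t) is false for non-monotone a_t; it is replaced by O(1/a_{t+1}) in general, with O(1/a_t) asserted only when a_t = O(a_{t+1}), e.g. for nondecreasing a_t. *)

theory Defs
  imports "HOL-Analysis.Analysis" "HOL-Library.Landau_Symbols"
begin

definition proper_fun :: "('a \<Rightarrow> ereal) \<Rightarrow> bool" where
  "proper_fun \<phi> \<longleftrightarrow> (\<forall>x. \<phi> x \<noteq> -\<infinity>) \<and> (\<exists>x. \<phi> x \<noteq> \<infinity>)"

definition lsc_fun :: "('a::topological_space \<Rightarrow> ereal) \<Rightarrow> bool" where
  "lsc_fun \<phi> \<longleftrightarrow> (\<forall>x. \<forall>c < \<phi> x. \<forall>\<^sub>F y in nhds x. c < \<phi> y)"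

text \<open>Only used for functions that never take the value \<open>-\<infinity>\<close>, so the sum on the right-hand side
  is unambiguous.\<close>

definition convex_fun :: "('a::real_vector \<Rightarrow> ereal) \<Rightarrow> bool" where
  "convex_fun \<phi> \<longleftrightarrow> (\<forall>x y. \<forall>\<theta>\<in>{0<..<1}.
     \<phi> (\<theta> *\<^sub>R x + (1 - \<theta>) *\<^sub>R y) \<le> ereal \<theta> * \<phi> x + ereal (1 - \<theta>) * \<phi> y)"

definition conjugate :: "('a::real_inner \<Rightarrow> ereal) \<Rightarrow> 'a \<Rightarrow> ereal" where
  "conjugate \<phi> u = (SUP w. ereal (w \<bullet> u) - \<phi> w)"

definition subdifferential :: "('a::real_inner \<Rightarrow> ereal) \<Rightarrow> 'a \<Rightarrow> 'a set" where
  "subdifferential \<phi> u = {s. \<forall>w. \<phi> u + ereal (s \<bullet> (w - u)) \<le> \<phi> w}"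

definition prox :: "('a::real_inner \<Rightarrow> ereal) \<Rightarrow> 'a \<Rightarrow> 'a" where
  "prox \<phi> u = arg_min (\<lambda>w. \<phi> w + ereal ((norm (w - u))\<^sup>2 / 2)) (\<lambda>_. True)"

text \<open>The subgradient of \<open>\<phi>\<close> at \<open>w = prox (c \<phi>) p\<close> that is singled out by the optimality condition of
  the proximal step.\<close>

definition prox_subgradient :: "('a::real_inner \<Rightarrow> ereal) \<Rightarrow> real \<Rightarrow> 'a \<Rightarrow> 'a \<Rightarrow> 'a" where
  "prox_subgradient \<phi> c w p = (THE s. s \<in> subdifferential \<phi> w \<and> w + c *\<^sub>R s = p)"

definition minimizer :: "('a \<Rightarrow> ereal) \<Rightarrow> 'a \<Rightarrow> bool" where
  "minimizer F x \<longleftrightarrow> is_arg_min F (\<lambda>_. True) x"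

definition primal_solution ::
  "('x \<Rightarrow> real) \<Rightarrow> ('u \<Rightarrow> ereal) \<Rightarrow> ('x \<Rightarrow> 'u) \<Rightarrow> 'x \<Rightarrow> bool" where
  "primal_solution f h K x \<longleftrightarrow> minimizer (\<lambda>x. ereal (f x) + h (K x)) x"

definition dual_solution ::
  "('x::real_inner \<Rightarrow> real) \<Rightarrow> ('u::real_inner \<Rightarrow> ereal) \<Rightarrow> ('x \<Rightarrow> 'u) \<Rightarrow> 'u \<Rightarrow> bool" where
  "dual_solution f h K u \<longleftrightarrow>
     minimizer (\<lambda>u. conjugate (\<lambda>x. ereal (f x)) (- adjoint K u) + conjugate h u) u"

definition saddle_point ::
  "('x::real_inner \<Rightarrow> 'x) \<Rightarrow> ('u::real_inner \<Rightarrow> ereal) \<Rightarrow> ('x \<Rightarrow> 'u) \<Rightarrow> 'x \<Rightarrow> 'u \<Rightarrow> bool" where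
  "saddle_point gradf h K x u \<longleftrightarrow>
     0 = gradf x + adjoint K u \<and> K x \<in> subdifferential (conjugate h) u"

definition lagrangian ::
  "('x \<Rightarrow> real) \<Rightarrow> ('u::real_inner \<Rightarrow> ereal) \<Rightarrow> ('x \<Rightarrow> 'u) \<Rightarrow> 'x \<Rightarrow> 'u \<Rightarrow> ereal" where
  "lagrangian f h K x u = ereal (f x) + ereal (K x \<bullet> u) - conjugate h u"

definition lagrangian_gap ::
  "('x \<Rightarrow> real) \<Rightarrow> ('u::real_inner \<Rightarrow> ereal) \<Rightarrow> ('x \<Rightarrow> 'u) \<Rightarrow> 'x \<Rightarrow> 'u \<Rightarrow> 'x \<Rightarrow> 'u \<Rightarrow> ereal" where
  "lagrangian_gap f h K xs us x u = lagrangian f h K x us - lagrangian f h K xs u"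

text \<open>The coarsest topology on a Hilbert space for which all functionals \<open>\<lambda>x. x \<bullet> w\<close> are continuous;
  the function space carries the product topology.\<close>

definition weak_topology :: "'a::real_inner topology" where
  "weak_topology = pullback_topology UNIV (\<lambda>x w. x \<bullet> w) (euclidean :: ('a \<Rightarrow> real) topology)"

abbreviation weakly_converges :: "(nat \<Rightarrow> 'a::real_inner) \<Rightarrow> 'a \<Rightarrow> bool" where
  "weakly_converges s l \<equiv> limitin weak_topology s l sequentially"

definition weak_cluster_point :: "(nat \<Rightarrow> 'a::real_inner) \<Rightarrow> 'a \<Rightarrow> bool" where
  "weak_cluster_point s l \<longleftrightarrow>
     (\<forall>W. openin weak_topology W \<and> l \<in> W \<longrightarrow> (\<exists>\<^sub>F n in sequentially. s n \<in> W))"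

lemma weakly_converges_iff:
  "weakly_converges s l \<longleftrightarrow> (\<forall>w. (\<lambda>n. s n \<bullet> w) \<longlonglongrightarrow> l \<bullet> w)"
proof -
  have "weakly_converges s l \<longleftrightarrow> (\<lambda>n w. s n \<bullet> w) \<longlonglongrightarrow> (\<lambda>w. l \<bullet> w)"
    unfolding limitin_def weak_topology_def tendsto_def
    by (auto simp: openin_pullback_topology topspace_pullback_topology)
  also have "\<dots> \<longleftrightarrow> (\<forall>w. (\<lambda>n. s n \<bullet> w) \<longlonglongrightarrow> l \<bullet> w)"
    using limitin_componentwise[of "\<lambda>_. euclidean :: real topology" UNIV
        "\<lambda>n w. s n \<bullet> w" "\<lambda>w. l \<bullet> w" sequentially]
    by (simp add: euclidean_product_topology)
  finally show ?thesis .
qed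

end

theory Submission
  imports Defs
begin

text \<open>
  Every dual component of a saddle point solves the dual problem, hence equals \<open>ustar\<close>, and the
  Lagrangian gap dominates the Bregman distance of \<open>f\<close> from \<open>x t\<close> to the saddle point. Since that
  distance is weakly lower semicontinuous, it vanishes at weak cluster points of \<open>x\<close>, which therefore all have the same gradient
  \<open>- adjoint K ustar\<close>. Passing to the limit in the subgradient inequality at \<open>v t\<close> bounds
  the upper limit of \<open>K (z t) \<bullet> (w - ustar)\<close> by
  \<open>conjugate h w - conjugate h ustar\<close>; this bound survives the averaging that turns \<open>z\<close> into \<open>x\<close>
  because the weights \<open>1 / a t\<close> have a divergent sum. So weak cluster points of \<open>x\<close> are saddle points.

  For the weak convergence, two cluster points \<open>p\<close> and \<open>q\<close> have the same image under \<open>K\<close> and thus the same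
  gap. In the difference of their Lyapunov functions only \<open>norm (z t - p)\<^sup>2 - norm (z t - q)\<^sup>2\<close> remains,
  so \<open>z t \<bullet> (p - q)\<close> converges, and by averaging so does \<open>x t \<bullet> (p - q)\<close>. Its
  limit is both \<open>p \<bullet> (p - q)\<close> and \<open>q \<bullet> (p - q)\<close>, whence \<open>p = q\<close>.\<close>

section \<open>Proximal points and the Riesz representation\<close>

lemma subdifferentialD:
  "s \<in> subdifferential \<phi> u \<Longrightarrow> \<phi> u + ereal (s \<bullet> (w - u)) \<le> \<phi> w"
  by (simp add: subdifferential_def)

text \<open>The parallelogram law, in the shape that \<open>convex_fun\<close> takes at
  \<open>1/2\<close>; the last term measures strong convexity.\<close>

lemma midpoint_norm_identity:
  fixes p q r :: "'a::real_inner"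
  shows "(norm ((1/2) *\<^sub>R p + (1 - 1/2) *\<^sub>R q - r))\<^sup>2 =
     (norm (p - r))\<^sup>2 / 2 + (norm (q - r))\<^sup>2 / 2 - (norm (p - q))\<^sup>2 / 4"
  unfolding power2_norm_eq_inner
  by (simp add: inner_diff_left inner_diff_right inner_add_left inner_add_right inner_commute field_simps)

text \<open>No compactness is involved: strong convexity of the quadratic makes every minimizing
  sequence Cauchy, completeness supplies a limit, and lower semicontinuity makes the limit a
  minimizer.\<close>

lemma quadratic_perturbation_has_minimizer:
  fixes \<phi> :: "'a::{real_inner,complete_space} \<Rightarrow> ereal"
  assumes conv: "convex_fun \<phi>" and lsc: "lsc_fun \<phi>" and fin: "\<phi> w0 \<noteq> \<infinity>"
    and bdd: "\<And>w. ereal m \<le> \<phi> w + ereal ((norm (w - p))\<^sup>2 / 2)"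
  obtains w where "\<And>w'. \<phi> w + ereal ((norm (w - p))\<^sup>2 / 2) \<le> \<phi> w' + ereal ((norm (w' - p))\<^sup>2 / 2)"
proof -
  define J where "J w = \<phi> w + ereal ((norm (w - p))\<^sup>2 / 2)" for w
  have not_minf: "\<phi> w \<noteq> -\<infinity>" for w
    using bdd[of w] by auto
  have mJ: "ereal m \<le> Inf (range J)"
    by (rule Inf_greatest) (auto simp: J_def bdd)
  moreover have "Inf (range J) \<le> J w0" by (rule Inf_lower) simp
  moreover have "J w0 < \<infinity>" using fin by (auto simp: J_def)
  ultimately obtain I where I: "Inf (range J) = ereal I"
    by (cases "Inf (range J)") auto
  have I_le: "ereal I \<le> J w" for w
    unfolding I[symmetric] by (rule Inf_lower) simp
  have "\<exists>w. J w < ereal (I + 1 / real (Suc n))" for n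
  proof -
    have "Inf (range J) < ereal (I + 1 / real (Suc n))" unfolding I by simp
    thus ?thesis by (auto simp: Inf_less_iff)
  qed
  then obtain s where s: "\<And>n. J (s n) < ereal (I + 1 / real (Suc n))" by metis
  \<comment> \<open>The midpoint has value at least \<open>I\<close>, but convexity and the
    parallelogram law put it an eighth of the squared distance below the average of the two
    values.\<close>
  have gap: "(norm (s i - s j))\<^sup>2 \<le> 4 * (1 / real (Suc i) + 1 / real (Suc j))" for i j
  proof -
    obtain ri rj where r: "\<phi> (s i) = ereal ri" "\<phi> (s j) = ereal rj"
      using s[of i] s[of j] not_minf[of "s i"] not_minf[of "s j"]
      by (cases "\<phi> (s i)"; cases "\<phi> (s j)") (auto simp: J_def)
    let ?m = "(1/2) *\<^sub>R s i + (1 - 1/2) *\<^sub>R s j"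
    have "\<phi> ?m \<le> ereal (1/2) * \<phi> (s i) + ereal (1 - 1/2) * \<phi> (s j)"
      using conv[unfolded convex_fun_def, rule_format, of "1/2" "s i" "s j"] by simp
    then obtain rm where rm: "\<phi> ?m = ereal rm" "rm \<le> ri / 2 + rj / 2"
      using not_minf[of ?m] by (cases "\<phi> ?m") (auto simp: r)
    have "I \<le> rm + (norm (?m - p))\<^sup>2 / 2" using I_le[of ?m] unfolding J_def rm(1) by simp
    moreover have "ri + (norm (s i - p))\<^sup>2 / 2 < I + 1 / real (Suc i)"
      "rj + (norm (s j - p))\<^sup>2 / 2 < I + 1 / real (Suc j)"
      using s[of i] s[of j] by (simp_all add: J_def r)
    ultimately show ?thesis using rm(2) unfolding midpoint_norm_identity by argo
  qed
  have "Cauchy s"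
  proof (rule CauchyI)
    fix e :: real assume e: "e > 0"
    obtain N where N: "1 / real (Suc N) < e\<^sup>2 / 8"
      using nat_approx_posE[of "e\<^sup>2/8"] e by auto
    have "norm (s i - s j) < e" if "i \<ge> N" "j \<ge> N" for i j
    proof -
      have "1 / real (Suc i) \<le> 1 / real (Suc N)" "1 / real (Suc j) \<le> 1 / real (Suc N)"
        using that by (simp_all add: frac_le)
      hence "(norm (s i - s j))\<^sup>2 < e\<^sup>2" using gap[of i j] N by argo
      thus ?thesis using e by (simp add: power_less_imp_less_base)
    qed
    thus "\<exists>M. \<forall>m\<ge>M. \<forall>n\<ge>M. norm (s m - s n) < e" by blast
  qed
  then obtain w where w: "s \<longlonglongrightarrow> w" by (auto simp: Cauchy_convergent_iff convergent_def)
  have q: "(\<lambda>n. (norm (s n - p))\<^sup>2 / 2) \<longlonglongrightarrow> (norm (w - p))\<^sup>2 / 2"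
    by (intro tendsto_intros w) simp
  \<comment> \<open>Reals strictly below \<open>\<phi> w\<close> stand in for
    \<open>\<phi> w\<close>, which is not yet known to be finite.\<close>
  have bound: "c + (norm (w - p))\<^sup>2 / 2 \<le> I" if c: "ereal c < \<phi> w" for c
  proof (rule tendsto_le[OF sequentially_bot])
    show "(\<lambda>n. I + 1 / real (Suc n)) \<longlonglongrightarrow> I"
      using tendsto_add[OF tendsto_const LIMSEQ_inverse_real_of_nat, of I]
      by (simp add: inverse_eq_divide)
    show "(\<lambda>n. c + (norm (s n - p))\<^sup>2 / 2) \<longlonglongrightarrow> c + (norm (w - p))\<^sup>2 / 2"
      by (intro tendsto_add tendsto_const q)
    have "\<forall>\<^sub>F n in sequentially. ereal c < \<phi> (s n)"
      using lsc c w unfolding lsc_fun_def filterlim_iff by blast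
    thus "\<forall>\<^sub>F n in sequentially. c + (norm (s n - p))\<^sup>2 / 2 \<le> I + 1 / real (Suc n)"
    proof eventually_elim
      case (elim n)
      thus ?case using s[of n] by (cases "\<phi> (s n)") (auto simp: J_def)
    qed
  qed
  have "J w \<le> ereal I"
  proof (cases "\<phi> w")
    case (real r)
    have "r + (norm (w - p))\<^sup>2 / 2 \<le> I"
    proof (rule field_le_epsilon)
      fix e :: real assume "e > 0"
      thus "r + (norm (w - p))\<^sup>2 / 2 \<le> I + e" using bound[of "r - e"] real by simp
    qed
    thus ?thesis by (simp add: J_def real)
  next
    case PInf
    \<comment> \<open>This choice of \<open>c\<close> turns \<open>bound\<close> into
      \<open>I + 1 \<le> I\<close>, so an infinite value is impossible.\<close>
    show ?thesis using bound[of "I + 1 - (norm (w - p))\<^sup>2 / 2"] PInf by simp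
  qed (simp add: not_minf)
  hence "J w \<le> J w'" for w' using I_le order_trans by blast
  thus thesis using that unfolding J_def by blast
qed

text \<open>Minimality is compared along the segment from \<open>w\<close> to \<open>w'\<close>;
  after division by \<open>\<theta>\<close> the quadratic remainder vanishes as
  \<open>\<theta>\<close> tends to 0.\<close>

lemma quadratic_minimizer_subgradient:
  fixes \<phi> :: "'a::real_inner \<Rightarrow> ereal"
  assumes conv: "convex_fun \<phi>" and proper: "proper_fun \<phi>"
    and min: "\<And>w'. \<phi> w + ereal ((norm (w - p))\<^sup>2 / 2) \<le> \<phi> w' + ereal ((norm (w' - p))\<^sup>2 / 2)"
  shows "p - w \<in> subdifferential \<phi> w"
proof -
  have not_minf: "\<phi> w \<noteq> -\<infinity>" for w
    using proper by (auto simp: proper_fun_def)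
  obtain w0 where "\<phi> w0 \<noteq> \<infinity>" using proper by (auto simp: proper_fun_def)
  then obtain r where r: "\<phi> w = ereal r"
    using min[of w0] not_minf[of w] by (cases "\<phi> w") auto
  have "\<phi> w + ereal ((p - w) \<bullet> (w' - w)) \<le> \<phi> w'" for w'
  proof (cases "\<phi> w'")
    case (real r')
    define d where "d = w' - w"
    have step: "r + (p - w) \<bullet> d - \<theta> * (norm d)\<^sup>2 / 2 \<le> r'" if \<theta>: "0 < \<theta>" "\<theta> < 1" for \<theta>
    proof -
      let ?m = "\<theta> *\<^sub>R w' + (1 - \<theta>) *\<^sub>R w"
      have m: "?m - p = (w - p) + \<theta> *\<^sub>R d" by (simp add: d_def algebra_simps)
      have "(norm (?m - p))\<^sup>2 = (norm (w - p))\<^sup>2 - 2 * \<theta> * ((p - w) \<bullet> d) + \<theta>\<^sup>2 * (norm d)\<^sup>2"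
        unfolding m power2_norm_eq_inner
        by (simp add: inner_add_left inner_add_right inner_diff_left inner_diff_right inner_commute power2_eq_square algebra_simps)
      moreover have "\<phi> ?m \<le> ereal \<theta> * \<phi> w' + ereal (1 - \<theta>) * \<phi> w"
        using conv \<theta> by (auto simp: convex_fun_def)
      then obtain rm where rm: "\<phi> ?m = ereal rm" "rm \<le> \<theta> * r' + (1 - \<theta>) * r"
        using not_minf[of ?m] by (cases "\<phi> ?m") (auto simp: r real)
      moreover have "r + (norm (w - p))\<^sup>2 / 2 \<le> rm + (norm (?m - p))\<^sup>2 / 2"
        using min[of ?m] by (simp add: r rm(1))
      ultimately have "0 \<le> \<theta> * (r' - r - (p - w) \<bullet> d + \<theta> * (norm d)\<^sup>2 / 2)"
        by (simp add: algebra_simps power2_eq_square)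
      thus ?thesis using \<theta> by (simp add: zero_le_mult_iff)
    qed
    have "r + (p - w) \<bullet> d \<le> r'"
    proof (rule tendsto_upperbound)
      show "((\<lambda>\<theta>. r + (p - w) \<bullet> d - \<theta> * (norm d)\<^sup>2 / 2) \<longlongrightarrow> r + (p - w) \<bullet> d) (at_right 0)"
        by (auto intro!: tendsto_eq_intros)
      show "\<forall>\<^sub>F \<theta> in at_right 0. r + (p - w) \<bullet> d - \<theta> * (norm d)\<^sup>2 / 2 \<le> r'"
        using eventually_at_right_real[of 0 1] by (rule eventually_mono) (auto intro: step)
    qed simp
    thus ?thesis by (simp add: r real d_def)
  qed (auto simp: r not_minf)
  thus ?thesis by (simp add: subdifferential_def)
qed

text \<open>\<open>prox\<close> is a choice among minimizers, so existence of one must come first;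
  the optimality condition then holds for the one chosen.\<close>

lemma prox_optimality:
  fixes \<phi> :: "'a::{real_inner,complete_space} \<Rightarrow> ereal"
  assumes conv: "convex_fun \<phi>" and lsc: "lsc_fun \<phi>" and proper: "proper_fun \<phi>"
    and bdd: "\<And>w. ereal m \<le> \<phi> w + ereal ((norm (w - p))\<^sup>2 / 2)"
  shows "p - prox \<phi> p \<in> subdifferential \<phi> (prox \<phi> p)"
proof -
  obtain w0 where "\<phi> w0 \<noteq> \<infinity>" using proper by (auto simp: proper_fun_def)
  then obtain w where "\<And>w'. \<phi> w + ereal ((norm (w - p))\<^sup>2 / 2) \<le> \<phi> w' + ereal ((norm (w' - p))\<^sup>2 / 2)"
    using quadratic_perturbation_has_minimizer[OF conv lsc _ bdd] by blast
  hence "is_arg_min (\<lambda>w. \<phi> w + ereal ((norm (w - p))\<^sup>2 / 2)) (\<lambda>_. True) w"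
    by (auto simp: is_arg_min_def not_less)
  hence "is_arg_min (\<lambda>w. \<phi> w + ereal ((norm (w - p))\<^sup>2 / 2)) (\<lambda>_. True) (prox \<phi> p)"
    unfolding prox_def arg_min_def by (rule someI)
  thus ?thesis
    by (intro quadratic_minimizer_subgradient conv proper) (auto simp: is_arg_min_def not_less)
qed

text \<open>The representing vector is the proximal point at the origin of the negated functional.\<close>

lemma riesz_representation:
  fixes l :: "'a::{real_inner,complete_space} \<Rightarrow> real"
  assumes "bounded_linear l"
  obtains q where "\<And>w. l w = w \<bullet> q"
proof -
  interpret bounded_linear l by fact
  obtain B where B: "\<And>w. norm (l w) \<le> norm w * B" using bounded by blast
  define \<phi> where "\<phi> w = ereal (- l w)" for w
  have "convex_fun \<phi>" by (simp add: convex_fun_def \<phi>_def add scale)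
  moreover have "lsc_fun \<phi>"
    unfolding lsc_fun_def
  proof (intro allI impI)
    fix w c assume c: "c < \<phi> w"
    have "(\<phi> \<longlongrightarrow> \<phi> w) (nhds w)" unfolding \<phi>_def
      by (intro tendsto_intros tendsto filterlim_ident)
    thus "\<forall>\<^sub>F y in nhds w. c < \<phi> y" using c by (rule order_tendstoD(1))
  qed
  moreover have "proper_fun \<phi>" by (simp add: proper_fun_def \<phi>_def)
  \<comment> \<open>Completing the square in \<open>norm w\<close> gives the constant.\<close>
  moreover have "ereal (- B\<^sup>2 / 2) \<le> \<phi> w + ereal ((norm (w - 0))\<^sup>2 / 2)" for w
  proof -
    have "0 \<le> (norm w - B)\<^sup>2" by simp
    hence "- B\<^sup>2 / 2 \<le> - (norm w * B) + (norm w)\<^sup>2 / 2"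
      by (simp add: power2_diff)
    thus ?thesis using B[of w] by (simp add: \<phi>_def)
  qed
  ultimately have "0 - prox \<phi> 0 \<in> subdifferential \<phi> (prox \<phi> 0)" by (rule prox_optimality)
  then obtain q where q: "0 - q \<in> subdifferential \<phi> q" by blast
  \<comment> \<open>The subgradient inequality at \<open>q + d\<close> bounds \<open>l d\<close>
    from one side; \<open>- d\<close> then gives the other.\<close>
  have le: "l d \<le> d \<bullet> q" for d
    using q[unfolded subdifferential_def, simplified, rule_format, of "q + d"]
    by (simp add: \<phi>_def add inner_commute)
  have "l d = d \<bullet> q" for d
    using le[of d] le[of "- d"] by (simp add: neg)
  thus thesis using that by blast
qed

text \<open>\<open>adjoint\<close> is chosen by its defining identity, so a witness has to be
  exhibited; Riesz supplies its value at each \<open>q\<close>.\<close>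

lemma inner_adjoint:
  fixes K :: "'a::{real_inner,complete_space} \<Rightarrow> 'b::real_inner"
  assumes "bounded_linear K"
  shows "K p \<bullet> q = p \<bullet> adjoint K q"
proof -
  have "\<exists>r. \<forall>p. K p \<bullet> q = p \<bullet> r" for q
    using riesz_representation[OF bounded_linear_inner_left_comp[OF assms, of q]] by blast
  hence "\<exists>K'. \<forall>p q. K p \<bullet> q = p \<bullet> K' q" by metis
  thus ?thesis unfolding adjoint_def by (rule someI2_ex) simp
qed

section \<open>Conjugate functions\<close>

text \<open>\<open>(w1, r1)\<close> is the projection of \<open>(w0, r0)\<close> onto the epigraph,
  obtained as a proximal point of its indicator function; the last inequality is the obtuse-angle
  property of projections.\<close>

lemma epigraph_projection:
  fixes h :: "'a::{real_inner,complete_space} \<Rightarrow> ereal"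
  assumes h: "proper_fun h" "lsc_fun h" "convex_fun h" and r0: "ereal r0 < h w0"
  obtains w1 r1 where "h w1 \<le> ereal r1" "r0 \<le> r1"
    "\<And>w r. h w \<le> ereal r \<Longrightarrow> (w0 - w1) \<bullet> (w - w1) + (r0 - r1) * (r - r1) \<le> 0"
proof -
  define \<phi> :: "'a \<times> real \<Rightarrow> ereal" where
    "\<phi> P = (if h (fst P) \<le> ereal (snd P) then 0 else \<infinity>)" for P
  have not_minf: "h w \<noteq> -\<infinity>" for w using h(1) by (auto simp: proper_fun_def)
  have "convex_fun \<phi>"
    unfolding convex_fun_def
  proof (intro allI ballI)
    fix P Q :: "'a \<times> real" and \<theta> :: real assume \<theta>: "\<theta> \<in> {0<..<1}"
    show "\<phi> (\<theta> *\<^sub>R P + (1 - \<theta>) *\<^sub>R Q) \<le> ereal \<theta> * \<phi> P + ereal (1 - \<theta>) * \<phi> Q"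
    proof (cases "h (fst P) \<le> ereal (snd P) \<and> h (fst Q) \<le> ereal (snd Q)")
      case True
      have "h (fst (\<theta> *\<^sub>R P + (1 - \<theta>) *\<^sub>R Q)) \<le> ereal \<theta> * h (fst P) + ereal (1 - \<theta>) * h (fst Q)"
        using h(3) \<theta> by (simp add: convex_fun_def)
      also have "\<dots> \<le> ereal \<theta> * ereal (snd P) + ereal (1 - \<theta>) * ereal (snd Q)"
        using True \<theta> by (intro add_mono ereal_mult_left_mono) auto
      finally show ?thesis using True by (simp add: \<phi>_def)
    next
      case False
      thus ?thesis using \<theta> by (auto simp: \<phi>_def)
    qed
  qed
  moreover have "lsc_fun \<phi>"
    unfolding lsc_fun_def
  proof (intro allI impI)
    fix P c assume c: "c < \<phi> P"
    show "\<forall>\<^sub>F Q in nhds P. c < \<phi> Q"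
    proof (cases "h (fst P) \<le> ereal (snd P)")
      case True
      hence "c < 0" using c by (simp add: \<phi>_def)
      thus ?thesis by (auto simp: \<phi>_def)
    next
      case False
      \<comment> \<open>The level \<open>d\<close> separates \<open>snd P\<close> from
        \<open>h (fst P)\<close>, and both strict inequalities persist near \<open>P\<close>, so the
        complement of the epigraph is open.\<close>
      then obtain d where d: "ereal (snd P) < ereal d" "ereal d < h (fst P)"
        using ereal_dense2[of "ereal (snd P)" "h (fst P)"] by (auto simp: not_le)
      have "\<forall>\<^sub>F w in nhds (fst P). ereal d < h w"
        using h(2) d(2) by (simp add: lsc_fun_def)
      hence "\<forall>\<^sub>F Q in nhds P. ereal d < h (fst Q)"
        using eventually_compose_filterlim[OF _ tendsto_fst[OF filterlim_ident]] by blast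
      moreover have "\<forall>\<^sub>F Q in nhds P. snd Q < d"
        using d(1) by (intro order_tendstoD(2)[OF tendsto_snd[OF filterlim_ident]]) simp
      ultimately show ?thesis
      proof eventually_elim
        case (elim Q)
        hence "\<not> h (fst Q) \<le> ereal (snd Q)"
          by (meson ereal_less_le less_ereal.simps(1) not_le order_less_trans)
        moreover have "c < \<infinity>" using c by (auto simp: less_le)
        ultimately show ?case by (simp add: \<phi>_def)
      qed
    qed
  qed
  moreover have "proper_fun \<phi>"
  proof -
    obtain w where "h w \<noteq> \<infinity>" using h(1) by (auto simp: proper_fun_def)
    then obtain r where "h w = ereal r" using not_minf[of w] by (cases "h w") auto
    hence "\<phi> (w, r) = 0" by (simp add: \<phi>_def)
    hence "\<phi> (w, r) \<noteq> \<infinity>" by simp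
    moreover have "\<phi> P \<noteq> -\<infinity>" for P by (simp add: \<phi>_def)
    ultimately show ?thesis unfolding proper_fun_def by blast
  qed
  moreover have "ereal 0 \<le> \<phi> P + ereal ((norm (P - (w0, r0)))\<^sup>2 / 2)" for P
    by (simp add: \<phi>_def)
  ultimately have "(w0, r0) - prox \<phi> (w0, r0) \<in> subdifferential \<phi> (prox \<phi> (w0, r0))"
    by (rule prox_optimality)
  then obtain w1 r1 where sub: "(w0 - w1, r0 - r1) \<in> subdifferential \<phi> (w1, r1)"
    by (metis prod.collapse minus_prod_def fst_conv snd_conv)
  \<comment> \<open>Otherwise \<open>\<phi>\<close> would be infinite at a point with a subgradient,
    hence everywhere.\<close>
  have in_epi: "h w1 \<le> ereal r1"
  proof (rule ccontr)
    assume "\<not> ?thesis"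
    hence "\<phi> (w1, r1) = \<infinity>" by (simp add: \<phi>_def)
    moreover have "\<phi> (w1, r1) + ereal ((w0 - w1, r0 - r1) \<bullet> (P - (w1, r1))) \<le> \<phi> P" for P
      by (rule subdifferentialD[OF sub])
    ultimately have "\<phi> P = \<infinity>" for P by simp
    thus False using \<open>proper_fun \<phi>\<close> by (simp add: proper_fun_def)
  qed
  have var: "(w0 - w1) \<bullet> (w - w1) + (r0 - r1) * (r - r1) \<le> 0" if "h w \<le> ereal r" for w r
  proof -
    have "\<phi> (w1, r1) + ereal ((w0 - w1, r0 - r1) \<bullet> ((w, r) - (w1, r1))) \<le> \<phi> (w, r)"
      by (rule subdifferentialD[OF sub])
    thus ?thesis using that in_epi by (simp add: \<phi>_def)
  qed
  \<comment> \<open>The epigraph is closed under moving upwards; one unit is enough to read off the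
    sign of \<open>r0 - r1\<close>.\<close>
  have "h w1 \<le> ereal (r1 + 1)" using in_epi order_trans by fastforce
  hence "r0 \<le> r1" using var[of w1 "r1 + 1"] by simp
  thus thesis using that in_epi var by blast
qed

text \<open>The separating hyperplane is not vertical here, so dividing by \<open>r1 - r0\<close>
  presents it as the graph of an affine function through \<open>(w1, r1)\<close>.\<close>

lemma affine_minorant_above_aux:
  fixes h :: "'a::real_inner \<Rightarrow> ereal"
  assumes not_minf: "\<And>w. h w \<noteq> -\<infinity>" and less: "r0 < r1"
    and var: "\<And>w r. h w \<le> ereal r \<Longrightarrow> (w0 - w1) \<bullet> (w - w1) + (r0 - r1) * (r - r1) \<le> 0"
  shows "\<exists>p b. (\<forall>w. ereal (w \<bullet> p - b) \<le> h w) \<and> r0 < w0 \<bullet> p - b"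
proof (intro exI conjI allI)
  let ?p = "(1 / (r1 - r0)) *\<^sub>R (w0 - w1)"
  show "ereal (w \<bullet> ?p - (w1 \<bullet> ?p - r1)) \<le> h w" for w
  proof (cases "h w")
    case (real r)
    have "(w0 - w1) \<bullet> (w - w1) \<le> (r1 - r0) * (r - r1)"
      using var[of w r] real by (simp add: algebra_simps)
    hence "(w0 - w1) \<bullet> (w - w1) / (r1 - r0) \<le> r - r1"
      using less by (simp add: pos_divide_le_eq mult.commute)
    moreover have "w \<bullet> ?p - w1 \<bullet> ?p = (w0 - w1) \<bullet> (w - w1) / (r1 - r0)"
      by (simp add: inner_diff_left inner_diff_right inner_commute diff_divide_distrib)
    ultimately show ?thesis by (simp add: real)
  qed (simp_all add: not_minf)
  have "w0 \<bullet> ?p - w1 \<bullet> ?p = (w0 - w1) \<bullet> (w0 - w1) / (r1 - r0)"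
    unfolding inner_diff_left[symmetric] by simp
  moreover have "\<dots> \<ge> 0" using less by simp
  ultimately show "r0 < w0 \<bullet> ?p - (w1 \<bullet> ?p - r1)" using less by linarith
qed

text \<open>Over a point where \<open>h\<close> is finite the hyperplane cannot be vertical:
  \<open>(w0, h w0)\<close> lies in the epigraph, so \<open>r0 = r1\<close> would force
  \<open>w0 = w1\<close> and then \<open>h w0 \<le> r0\<close>.\<close>

lemma affine_minorant_above_finite:
  fixes h :: "'a::{real_inner,complete_space} \<Rightarrow> ereal"
  assumes h: "proper_fun h" "lsc_fun h" "convex_fun h" and r0: "ereal r0 < h w0" and fin: "h w0 \<noteq> \<infinity>"
  shows "\<exists>p b. (\<forall>w. ereal (w \<bullet> p - b) \<le> h w) \<and> r0 < w0 \<bullet> p - b"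
proof -
  obtain w1 r1 where wr: "h w1 \<le> ereal r1" "r0 \<le> r1"
    and var: "\<And>w r. h w \<le> ereal r \<Longrightarrow> (w0 - w1) \<bullet> (w - w1) + (r0 - r1) * (r - r1) \<le> 0"
    using epigraph_projection[OF h r0] by blast
  have "r0 \<noteq> r1"
  proof
    assume eq: "r0 = r1"
    obtain r where "h w0 = ereal r" using r0 fin by (cases "h w0") auto
    hence "(w0 - w1) \<bullet> (w0 - w1) \<le> 0" using var[of w0 r] eq by simp
    hence "w0 = w1" by (metis eq_iff_diff_eq_0 inner_gt_zero_iff not_le)
    thus False using wr(1) r0 eq by (simp add: leD)
  qed
  thus ?thesis using wr(2) h(1) var
    by (intro affine_minorant_above_aux[of h r0 r1]) (auto simp: proper_fun_def)
qed

text \<open>A vertical separating hyperplane is tilted by adding a large multiple of it to some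
  affine minorant.\<close>

lemma affine_minorant_above:
  fixes h :: "'a::{real_inner,complete_space} \<Rightarrow> ereal"
  assumes h: "proper_fun h" "lsc_fun h" "convex_fun h" and r0: "ereal r0 < h w0"
  shows "\<exists>p b. (\<forall>w. ereal (w \<bullet> p - b) \<le> h w) \<and> r0 < w0 \<bullet> p - b"
proof -
  have not_minf: "h w \<noteq> -\<infinity>" for w using h(1) by (auto simp: proper_fun_def)
  obtain w1 r1 where wr: "h w1 \<le> ereal r1" "r0 \<le> r1"
    and var: "\<And>w r. h w \<le> ereal r \<Longrightarrow> (w0 - w1) \<bullet> (w - w1) + (r0 - r1) * (r - r1) \<le> 0"
    using epigraph_projection[OF h r0] by blast
  show ?thesis
  proof (cases "r0 = r1")
    case False
    thus ?thesis using wr(2) not_minf var by (intro affine_minorant_above_aux[of h r0 r1]) auto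
  next
    case True
    define d where "d = w0 - w1"
    have "w0 \<noteq> w1" using wr(1) r0 True by (auto simp: leD)
    hence d_pos: "d \<bullet> d > 0" by (simp add: d_def)
    obtain wd where "h wd \<noteq> \<infinity>" using h(1) by (auto simp: proper_fun_def)
    then obtain rd where rd: "h wd = ereal rd" using not_minf[of wd] by (cases "h wd") auto
    obtain p b where pb: "\<And>w. ereal (w \<bullet> p - b) \<le> h w"
      using affine_minorant_above_finite[OF h, of "rd - 1" wd] rd by auto
    \<comment> \<open>The multiple is chosen so that \<open>s * (d \<bullet> d)\<close> exceeds the
      deficit of the affine minorant at \<open>w0\<close>; the added 1 makes this strict.\<close>
    define s where "s = (\<bar>r0 - (w0 \<bullet> p - b)\<bar> + 1) / (d \<bullet> d)"
    have s: "s > 0" "s * (d \<bullet> d) > r0 - (w0 \<bullet> p - b)"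
      using d_pos by (auto simp: s_def)
    show ?thesis
    proof (intro exI conjI allI)
      show "ereal (w \<bullet> (p + s *\<^sub>R d) - (b + s * (w1 \<bullet> d))) \<le> h w" for w
      proof (cases "h w")
        case (real r)
        have "d \<bullet> (w - w1) \<le> 0" using var[of w r] real True by (simp add: d_def)
        hence "s * (d \<bullet> (w - w1)) \<le> 0" using s(1) by (simp add: mult_le_0_iff)
        moreover have "w \<bullet> p - b \<le> r" using pb[of w] real by simp
        ultimately show ?thesis
          by (simp add: real inner_add_right inner_diff_right inner_commute algebra_simps)
      qed (simp_all add: not_minf)
      have "w0 \<bullet> (p + s *\<^sub>R d) - (b + s * (w1 \<bullet> d)) = w0 \<bullet> p - b + s * (d \<bullet> d)"
        by (simp add: d_def inner_add_right inner_diff_right inner_diff_left inner_commute algebra_simps)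
      thus "r0 < w0 \<bullet> (p + s *\<^sub>R d) - (b + s * (w1 \<bullet> d))" using s(2) by linarith
    qed
  qed
qed

section \<open>Biconjugation and regularity of the conjugate\<close>

lemma fenchel_young: "ereal (w \<bullet> u) - h w \<le> conjugate h u"
  unfolding conjugate_def by (rule SUP_upper) simp

lemma conjugate_le:
  assumes "\<And>w. ereal (w \<bullet> p - b) \<le> h w"
  shows "conjugate h p \<le> ereal b"
  unfolding conjugate_def
proof (rule SUP_least)
  fix w show "ereal (w \<bullet> p) - h w \<le> ereal b"
    using assms[of w] by (cases "h w") auto
qed

text \<open>A real strictly between the two sides would be exceeded at \<open>w\<close> by an affine
  minorant of \<open>h\<close>; its slope \<open>p\<close> has conjugate value at most
  \<open>b\<close>, so the biconjugate exceeds that real too.\<close>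

lemma fenchel_moreau:
  fixes h :: "'a::{real_inner,complete_space} \<Rightarrow> ereal"
  assumes h: "proper_fun h" "lsc_fun h" "convex_fun h"
  shows "h w \<le> conjugate (conjugate h) w"
proof (rule ccontr)
  assume "\<not> ?thesis"
  then obtain r where r: "conjugate (conjugate h) w < ereal r" "ereal r < h w"
    using ereal_dense2 by (metis not_le)
  then obtain p b where pb: "\<And>w'. ereal (w' \<bullet> p - b) \<le> h w'" "r < w \<bullet> p - b"
    using affine_minorant_above[OF h] by blast
  have "ereal r \<le> ereal (p \<bullet> w) - ereal b" using pb(2) by (simp add: inner_commute)
  also have "\<dots> \<le> ereal (p \<bullet> w) - conjugate h p"
    using conjugate_le[of p b h] pb(1) by (intro ereal_minus_mono) auto
  also have "\<dots> \<le> conjugate (conjugate h) w" by (rule fenchel_young)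
  finally show False using r(1) by simp
qed

text \<open>A finite value of \<open>h\<close> keeps the conjugate above minus infinity; an affine
  minorant of \<open>h\<close> makes it finite at its slope.\<close>

lemma proper_conjugate:
  fixes h :: "'a::{real_inner,complete_space} \<Rightarrow> ereal"
  assumes h: "proper_fun h" "lsc_fun h" "convex_fun h"
  shows "proper_fun (conjugate h)"
proof -
  obtain w where "h w \<noteq> \<infinity>" "h w \<noteq> -\<infinity>" using h(1) by (auto simp: proper_fun_def)
  then obtain r where r: "h w = ereal r" by (cases "h w") auto
  have "conjugate h u \<noteq> -\<infinity>" for u
    using fenchel_young[of w u h] r by auto
  moreover obtain p b where "\<And>w'. ereal (w' \<bullet> p - b) \<le> h w'"
    using affine_minorant_above[OF h, of "r - 1" w] r by auto
  hence "conjugate h p \<le> ereal b" by (rule conjugate_le)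
  hence "conjugate h p \<noteq> \<infinity>" by auto
  ultimately show ?thesis by (auto simp: proper_fun_def)
qed

lemma convex_conjugate:
  fixes h :: "'a::real_inner \<Rightarrow> ereal"
  assumes h: "proper_fun h"
  shows "convex_fun (conjugate h)"
  unfolding convex_fun_def
proof (intro allI ballI)
  fix u u' :: 'a and \<theta> :: real assume \<theta>: "\<theta> \<in> {0<..<1}"
  show "conjugate h (\<theta> *\<^sub>R u + (1 - \<theta>) *\<^sub>R u')
      \<le> ereal \<theta> * conjugate h u + ereal (1 - \<theta>) * conjugate h u'"
    unfolding conjugate_def[of h "\<theta> *\<^sub>R u + (1 - \<theta>) *\<^sub>R u'"]
  proof (rule SUP_least)
    fix w
    have not_minf: "h w \<noteq> -\<infinity>" using h by (simp add: proper_fun_def)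
    show "ereal (w \<bullet> (\<theta> *\<^sub>R u + (1 - \<theta>) *\<^sub>R u')) - h w
      \<le> ereal \<theta> * conjugate h u + ereal (1 - \<theta>) * conjugate h u'"
    proof (cases "h w")
      case (real r)
      have "ereal \<theta> * ereal (w \<bullet> u - r) + ereal (1 - \<theta>) * ereal (w \<bullet> u' - r)
        \<le> ereal \<theta> * conjugate h u + ereal (1 - \<theta>) * conjugate h u'"
        using fenchel_young[of w u h] fenchel_young[of w u' h] real \<theta>
        by (intro add_mono ereal_mult_left_mono) auto
      thus ?thesis by (simp add: real inner_add_right algebra_simps)
    qed (simp_all add: not_minf)
  qed
qed

text \<open>A supremum exceeds \<open>c\<close> as soon as one of its continuous affine members
  does, and that member still exceeds \<open>c\<close> nearby.\<close>

lemma lsc_conjugate: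
  fixes h :: "'a::real_inner \<Rightarrow> ereal"
  assumes h: "proper_fun h"
  shows "lsc_fun (conjugate h)"
  unfolding lsc_fun_def
proof (intro allI impI)
  fix u c assume "c < conjugate h u"
  then obtain w where w: "c < ereal (w \<bullet> u) - h w" by (auto simp: conjugate_def less_SUP_iff)
  have "h w \<noteq> -\<infinity>" using h by (simp add: proper_fun_def)
  then obtain r where r: "h w = ereal r" using w by (cases "h w") auto
  have "((\<lambda>u. ereal (w \<bullet> u - r)) \<longlongrightarrow> ereal (w \<bullet> u - r)) (nhds u)"
    by (intro tendsto_intros filterlim_ident)
  hence "\<forall>\<^sub>F u' in nhds u. c < ereal (w \<bullet> u' - r)"
    using w r by (intro order_tendstoD(1)) auto
  thus "\<forall>\<^sub>F u' in nhds u. c < conjugate h u'"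
  proof eventually_elim
    case (elim u')
    thus ?case using fenchel_young[of w u' h] r by auto
  qed
qed

section \<open>Scaled functions and the proximal step on the conjugate\<close>

lemma proper_fun_scale:
  assumes "c > 0" "proper_fun \<phi>" shows "proper_fun (\<lambda>w. ereal c * \<phi> w)"
  using assms by (auto simp: proper_fun_def ereal_mult_eq_MInfty ereal_mult_eq_PInfty)

lemma convex_fun_scale:
  assumes c: "c > 0" and \<phi>: "proper_fun \<phi>" "convex_fun \<phi>"
  shows "convex_fun (\<lambda>w. ereal c * \<phi> w)"
  unfolding convex_fun_def
proof (intro allI ballI)
  fix x y and \<theta> :: real assume \<theta>: "\<theta> \<in> {0<..<1}"
  have "ereal c * \<phi> (\<theta> *\<^sub>R x + (1 - \<theta>) *\<^sub>R y) \<le> ereal c * (ereal \<theta> * \<phi> x + ereal (1 - \<theta>) * \<phi> y)"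
    using c \<phi>(2) \<theta> by (intro ereal_mult_left_mono) (auto simp: convex_fun_def)
  also have "\<dots> = ereal \<theta> * (ereal c * \<phi> x) + ereal (1 - \<theta>) * (ereal c * \<phi> y)"
    using \<phi>(1) c \<theta> by (cases "\<phi> x"; cases "\<phi> y") (auto simp: proper_fun_def algebra_simps)
  finally show "ereal c * \<phi> (\<theta> *\<^sub>R x + (1 - \<theta>) *\<^sub>R y)
    \<le> ereal \<theta> * (ereal c * \<phi> x) + ereal (1 - \<theta>) * (ereal c * \<phi> y)" .
qed

lemma lsc_fun_scale:
  assumes c: "c > 0" and \<phi>: "lsc_fun \<phi>"
  shows "lsc_fun (\<lambda>w. ereal c * \<phi> w)"
  unfolding lsc_fun_def
proof (intro allI impI)
  fix x d assume "d < ereal c * \<phi> x"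
  hence "d / ereal c < \<phi> x" using c by (simp add: ereal_divide_less_iff mult.commute)
  hence "\<forall>\<^sub>F y in nhds x. d / ereal c < \<phi> y" using \<phi> by (simp add: lsc_fun_def)
  thus "\<forall>\<^sub>F y in nhds x. d < ereal c * \<phi> y" using c by (simp add: ereal_divide_less_iff mult.commute)
qed

text \<open>The equation \<open>w + c *\<^sub>R s = p\<close> alone determines \<open>s\<close>, so
  the definite description denotes a subgradient once the optimality condition is divided by
  \<open>c\<close>.\<close>

lemma prox_subgradient_conjugate:
  fixes h :: "'a::{real_inner,complete_space} \<Rightarrow> ereal"
  assumes h: "proper_fun h" "lsc_fun h" "convex_fun h" and c: "c > 0"
    and w: "w = prox (\<lambda>w. ereal c * conjugate h w) p"
  shows "prox_subgradient (conjugate h) c w p \<in> subdifferential (conjugate h) w"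
proof -
  note H = proper_conjugate[OF h] convex_conjugate[OF h(1)] lsc_conjugate[OF h(1)]
  obtain w0 where "h w0 \<noteq> \<infinity>" "h w0 \<noteq> -\<infinity>" using h(1) by (auto simp: proper_fun_def)
  then obtain b where b: "h w0 = ereal b" by (cases "h w0") auto
  \<comment> \<open>The minimum over \<open>q\<close> of the quadratic with the conjugate replaced
    by its affine minorant \<open>w0 \<bullet> q - b\<close>; it is attained at
    \<open>p - c *\<^sub>R w0\<close>.\<close>
  let ?m = "c * (w0 \<bullet> p - b) - c\<^sup>2 * (norm w0)\<^sup>2 / 2"
  have "ereal ?m \<le> ereal c * conjugate h q + ereal ((norm (q - p))\<^sup>2 / 2)" for q
  proof -
    have "(norm (q - p + c *\<^sub>R w0))\<^sup>2
        = (norm (q - p))\<^sup>2 + 2 * (c * (w0 \<bullet> q)) - 2 * (c * (w0 \<bullet> p)) + c\<^sup>2 * (norm w0)\<^sup>2"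
      unfolding power2_norm_eq_inner
      by (simp add: inner_add_left inner_add_right inner_diff_left inner_diff_right inner_commute
          power2_eq_square algebra_simps)
    moreover have "0 \<le> (norm (q - p + c *\<^sub>R w0))\<^sup>2" by simp
    ultimately have "?m \<le> c * (w0 \<bullet> q - b) + (norm (q - p))\<^sup>2 / 2"
      unfolding right_diff_distrib by linarith
    hence "ereal ?m \<le> ereal c * ereal (w0 \<bullet> q - b) + ereal ((norm (q - p))\<^sup>2 / 2)" by simp
    also have "\<dots> \<le> ereal c * conjugate h q + ereal ((norm (q - p))\<^sup>2 / 2)"
      using fenchel_young[of w0 q h] b c by (intro add_right_mono ereal_mult_left_mono) auto
    finally show ?thesis .
  qed
  from prox_optimality[OF convex_fun_scale[OF c H(1,2)] lsc_fun_scale[OF c H(3)] proper_fun_scale[OF c H(1)] this]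
  have sub: "p - w \<in> subdifferential (\<lambda>w. ereal c * conjugate h w) w" unfolding w .
  let ?s = "(1 / c) *\<^sub>R (p - w)"
  have "conjugate h w + ereal (?s \<bullet> (q - w)) \<le> conjugate h q" for q
  proof -
    have le: "ereal c * conjugate h w + ereal ((p - w) \<bullet> (q - w)) \<le> ereal c * conjugate h q"
      using sub by (simp add: subdifferential_def)
    have nm: "conjugate h w \<noteq> -\<infinity>" "conjugate h q \<noteq> -\<infinity>"
      using H(1) by (auto simp: proper_fun_def)
    show ?thesis
    proof (cases "conjugate h q")
      case (real r')
      then obtain r where r: "conjugate h w = ereal r"
        using nm le c by (cases "conjugate h w") auto
      have "c * r + (p - w) \<bullet> (q - w) \<le> c * r'" using le r real by simp
      hence "r + (p - w) \<bullet> (q - w) / c \<le> r'" using c by (simp add: field_simps)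
      thus ?thesis by (simp add: r real)
    qed (simp_all add: nm)
  qed
  hence "?s \<in> subdifferential (conjugate h) w" by (simp add: subdifferential_def)
  moreover have "w + c *\<^sub>R ?s = p" using c by simp
  moreover have "s = ?s" if "w + c *\<^sub>R s = p" for s using that c by auto
  ultimately have "prox_subgradient (conjugate h) c w p = ?s"
    unfolding prox_subgradient_def by (intro the_equality) blast+
  thus ?thesis using \<open>?s \<in> subdifferential (conjugate h) w\<close> by simp
qed

section \<open>Smooth convex functions\<close>

lemma line_derivative:
  fixes f :: "'a::real_inner \<Rightarrow> real"
  assumes "\<And>p. GDERIV f p :> g p"
  shows "((\<lambda>s. f (p + s *\<^sub>R d)) has_real_derivative d \<bullet> g (p + s *\<^sub>R d)) (at s within S)"
proof -
  have "(f has_derivative (\<lambda>h. h \<bullet> g (p + s *\<^sub>R d))) (at (p + s *\<^sub>R d))"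
    using assms by (simp add: gderiv_def)
  moreover have "((\<lambda>s. p + s *\<^sub>R d) has_derivative (\<lambda>h. h *\<^sub>R d)) (at s within S)"
    by (auto intro!: derivative_eq_intros)
  ultimately have "((\<lambda>s. f (p + s *\<^sub>R d)) has_derivative (\<lambda>h. (h *\<^sub>R d) \<bullet> g (p + s *\<^sub>R d))) (at s within S)"
    by (rule has_derivative_compose[rotated])
  thus ?thesis by (simp add: has_field_derivative_def mult.commute[of _ "_ \<bullet> _"])
qed

text \<open>Restriction to the line through \<open>p\<close> and \<open>q\<close> reduces this to
  the one-variable tangent inequality.\<close>

lemma convex_above_tangent:
  fixes f :: "'a::real_inner \<Rightarrow> real"
  assumes f: "convex_on UNIV f" and g: "\<And>p. GDERIV f p :> g p"
  shows "f q \<ge> f p + g p \<bullet> (q - p)"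
proof -
  let ?\<phi> = "\<lambda>s. f (p + s *\<^sub>R (q - p))"
  have "convex_on UNIV ?\<phi>"
  proof (rule convex_onI)
    fix t r s :: real assume t: "0 < t" "t < 1"
    have "p + ((1 - t) *\<^sub>R r + t *\<^sub>R s) *\<^sub>R (q - p)
      = (1 - t) *\<^sub>R (p + r *\<^sub>R (q - p)) + t *\<^sub>R (p + s *\<^sub>R (q - p))"
      by (simp add: algebra_simps)
    thus "?\<phi> ((1 - t) *\<^sub>R r + t *\<^sub>R s) \<le> (1 - t) * ?\<phi> r + t * ?\<phi> s"
      using convex_onD[OF f, of t] t by simp
  qed simp
  \<comment> \<open>The term with factor 0 stays unsimplified so that it matches
    \<open>line_derivative\<close> at parameter 0.\<close>
  hence "(q - p) \<bullet> g (p + 0 *\<^sub>R (q - p)) * (1 - 0) \<le> ?\<phi> 1 - ?\<phi> 0"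
    by (rule convex_on_imp_above_tangent) (simp_all add: line_derivative[OF g] del: scaleR_zero_left)
  thus ?thesis by (simp add: inner_commute)
qed

text \<open>Along the segment, \<open>f\<close> minus its quadratic model is nonincreasing:
  Cauchy-Schwarz and the Lipschitz bound make its derivative nonpositive.\<close>

lemma descent_lemma:
  fixes f :: "'a::real_inner \<Rightarrow> real"
  assumes g: "\<And>p. GDERIV f p :> g p" and lip: "L-lipschitz_on UNIV g"
  shows "f (p + d) \<le> f p + d \<bullet> g p + L / 2 * (norm d)\<^sup>2"
proof -
  let ?\<phi> = "\<lambda>s. f (p + s *\<^sub>R d) - (s * (d \<bullet> g p) + L / 2 * s\<^sup>2 * (norm d)\<^sup>2)"
  have "?\<phi> 1 \<le> ?\<phi> 0"
  proof (rule DERIV_nonpos_imp_nonincreasing[of 0 1 ?\<phi>])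
    fix s :: real assume s: "0 \<le> s" "s \<le> 1"
    have "d \<bullet> (g (p + s *\<^sub>R d) - g p) \<le> norm d * norm (g (p + s *\<^sub>R d) - g p)"
      by (rule norm_cauchy_schwarz)
    also have "\<dots> \<le> norm d * (L * norm (s *\<^sub>R d))"
      using lipschitz_onD[OF lip, of "p + s *\<^sub>R d" p]
      by (intro mult_left_mono) (simp_all add: dist_norm)
    also have "\<dots> = L * s * (norm d)\<^sup>2" using s by (simp add: power2_eq_square)
    finally have "d \<bullet> g (p + s *\<^sub>R d) - (d \<bullet> g p + L * s * (norm d)\<^sup>2) \<le> 0"
      by (simp add: inner_diff_right)
    moreover have "(?\<phi> has_real_derivative d \<bullet> g (p + s *\<^sub>R d) - (d \<bullet> g p + L * s * (norm d)\<^sup>2)) (at s)"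
      by (rule derivative_eq_intros line_derivative[OF g] refl)+ simp
    ultimately show "\<exists>y. DERIV ?\<phi> s :> y \<and> y \<le> 0" by blast
  qed simp
  thus ?thesis by simp
qed

text \<open>\<open>f - g q\<close> is minimal at \<open>q\<close>; compare its minimum with its value after a gradient
  step of length \<open>1 / L\<close> from \<open>p\<close>.\<close>

lemma gradient_difference_bound:
  fixes f :: "'a::real_inner \<Rightarrow> real"
  assumes f: "convex_on UNIV f" and g: "\<And>p. GDERIV f p :> g p"
    and L: "L > 0" and lip: "L-lipschitz_on UNIV g"
  shows "(norm (g p - g q))\<^sup>2 \<le> 2 * L * (f p - f q - g q \<bullet> (p - q))"
proof -
  define d where "d = g p - g q"
  let ?e = "- (1 / L) *\<^sub>R d"
  have "f q + g q \<bullet> (p + ?e - q) \<le> f (p + ?e)" by (rule convex_above_tangent[OF f g])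
  also have "\<dots> \<le> f p + ?e \<bullet> g p + L / 2 * (norm ?e)\<^sup>2" by (rule descent_lemma[OF g lip])
  also have "(norm ?e)\<^sup>2 = (norm d)\<^sup>2 / L\<^sup>2" by (simp add: power_divide)
  also have "L / 2 * \<dots> = (norm d)\<^sup>2 / (2 * L)" using L by (simp add: power2_eq_square)
  finally have "f q + g q \<bullet> (p - q) - (1 / L) * (g q \<bullet> d) \<le> f p - (1 / L) * (g p \<bullet> d) + (norm d)\<^sup>2 / (2 * L)"
    by (simp add: inner_add_right inner_diff_right inner_commute)
  moreover have "(1 / L) * (g p \<bullet> d) - (1 / L) * (g q \<bullet> d) = (norm d)\<^sup>2 / L"
    unfolding power2_norm_eq_inner d_def by (simp add: inner_diff_left diff_divide_distrib)
  ultimately have "(norm d)\<^sup>2 / L - (norm d)\<^sup>2 / (2 * L) \<le> f p - f q - g q \<bullet> (p - q)" by linarith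
  also have "(norm d)\<^sup>2 / L - (norm d)\<^sup>2 / (2 * L) = (norm d)\<^sup>2 / (2 * L)" by (simp add: field_simps)
  finally show ?thesis using L by (simp add: d_def field_simps)
qed

section \<open>Relaxed averages\<close>

text \<open>Once \<open>c\<close> is below \<open>B + \<epsilon> / 2\<close>, each step shrinks the
  excess of \<open>e\<close> over that level by a factor at most \<open>exp (- \<rho> t)\<close>;
  divergence of the sum drives the product of these factors to 0.\<close>

lemma relaxed_average_limsup:
  fixes e c \<rho> :: "nat \<Rightarrow> real"
  assumes step: "\<And>t. e (Suc t) \<le> (1 - \<rho> t) * e t + \<rho> t * c t"
    and \<rho>: "\<And>t. 0 \<le> \<rho> t" "\<And>t. \<rho> t \<le> 1"
    and div: "filterlim (\<lambda>n. \<Sum>t<n. \<rho> t) at_top sequentially"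
    and c: "\<And>\<epsilon>. \<epsilon> > 0 \<Longrightarrow> \<forall>\<^sub>F t in sequentially. c t \<le> B + \<epsilon>"
    and \<epsilon>: "\<epsilon> > 0"
  shows "\<forall>\<^sub>F t in sequentially. e t \<le> B + \<epsilon>"
proof -
  obtain T where T: "\<And>t. t \<ge> T \<Longrightarrow> c t \<le> B + \<epsilon> / 2"
    using c[of "\<epsilon> / 2"] \<epsilon> by (auto simp: eventually_sequentially)
  \<comment> \<open>Clipping at 0 keeps the bound nonnegative, which replacing
    \<open>1 - \<rho> t\<close> by the exponential requires.\<close>
  define C where "C = max 0 (e T - (B + \<epsilon> / 2))"
  define S where "S n = (\<Sum>t<n. \<rho> t)" for n
  have bound: "e t - (B + \<epsilon> / 2) \<le> exp (S T - S t) * C" if "t \<ge> T" for t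
    using that
  proof (induction t rule: dec_induct)
    case (step t)
    have "e (Suc t) - (B + \<epsilon> / 2) \<le> (1 - \<rho> t) * (e t - (B + \<epsilon> / 2)) + \<rho> t * (c t - (B + \<epsilon> / 2))"
      using assms(1)[of t] by (simp add: field_simps)
    also have "\<dots> \<le> (1 - \<rho> t) * (exp (S T - S t) * C) + 0"
      using step T[of t] \<rho>[of t] by (intro add_mono mult_left_mono mult_nonneg_nonpos) auto
    also have "\<dots> \<le> exp (- \<rho> t) * (exp (S T - S t) * C)"
      using exp_ge_add_one_self[of "- \<rho> t"] by (simp add: C_def mult_right_mono)
    also have "\<dots> = exp (S T - S (Suc t)) * C" by (simp add: S_def exp_diff exp_add exp_minus field_simps)
    finally show ?case .
  qed (simp add: C_def)
  have "filterlim (\<lambda>t. S T - S t) at_bot sequentially"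
    using filterlim_tendsto_add_at_top[OF tendsto_const[of "- S T"] div]
    by (subst filterlim_uminus_at_bot) (simp add: S_def)
  hence "(\<lambda>t. exp (S T - S t)) \<longlonglongrightarrow> 0"
    using exp_at_bot filterlim_compose by blast
  hence "(\<lambda>t. exp (S T - S t) * C) \<longlonglongrightarrow> 0" by (rule tendsto_mult_left_zero)
  hence "\<forall>\<^sub>F t in sequentially. exp (S T - S t) * C < \<epsilon> / 2"
    using \<epsilon> by (intro order_tendstoD(2)) auto
  moreover have "\<forall>\<^sub>F t in sequentially. t \<ge> T" by (rule eventually_ge_at_top)
  ultimately show ?thesis
  proof eventually_elim
    case (elim t)
    thus ?case using bound[of t] by linarith
  qed
qed

lemma relaxed_average_tendsto:
  fixes e c \<rho> :: "nat \<Rightarrow> real"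
  assumes step: "\<And>t. e (Suc t) = (1 - \<rho> t) * e t + \<rho> t * c t"
    and \<rho>: "\<And>t. 0 \<le> \<rho> t" "\<And>t. \<rho> t \<le> 1"
    and div: "filterlim (\<lambda>n. \<Sum>t<n. \<rho> t) at_top sequentially"
    and c: "c \<longlonglongrightarrow> B"
  shows "e \<longlonglongrightarrow> B"
proof (rule tendstoI)
  fix \<epsilon> :: real assume \<epsilon>: "\<epsilon> > 0"
  have "\<forall>\<^sub>F t in sequentially. e t \<le> B + \<epsilon> / 2"
  proof (rule relaxed_average_limsup[OF _ \<rho> div])
    show "\<forall>\<^sub>F t in sequentially. c t \<le> B + \<delta>" if "\<delta> > 0" for \<delta>
      using order_tendstoD(2)[OF c, of "B + \<delta>"] that by (auto elim: eventually_mono)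
  qed (use \<epsilon> step in auto)
  moreover have "\<forall>\<^sub>F t in sequentially. - e t \<le> - B + \<epsilon> / 2"
  proof (rule relaxed_average_limsup[OF _ \<rho> div, of _ "\<lambda>t. - c t"])
    show "\<forall>\<^sub>F t in sequentially. - c t \<le> - B + \<delta>" if "\<delta> > 0" for \<delta>
      using order_tendstoD(1)[OF c, of "B - \<delta>"] that by (auto elim: eventually_mono)
  qed (use \<epsilon> step in \<open>auto simp: algebra_simps\<close>)
  ultimately show "\<forall>\<^sub>F t in sequentially. dist (e t) B < \<epsilon>"
  proof eventually_elim
    case (elim t)
    thus ?case using \<epsilon> by (simp add: dist_real_def abs_less_iff)
  qed
qed

section \<open>Weak cluster points\<close>

lemma openin_weak_halfspace: "openin weak_topology {p. p \<bullet> w < (c::real)}"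
proof -
  have "open {g :: 'a \<Rightarrow> real. g w < c}"
    by (intro open_Collect_less continuous_on_product_coordinates continuous_on_const)
  thus ?thesis
    by (auto simp: weak_topology_def openin_pullback_topology intro!: exI[of _ "{g. g w < c}"])
qed

text \<open>Were \<open>l\<close> beyond \<open>B + e\<close>, the sequence would visit that open
  half-space infinitely often. Negating \<open>w\<close> turns it into a half-space of the available
  form.\<close>

lemma weak_cluster_point_le:
  assumes "weak_cluster_point s l" "\<And>\<epsilon>. \<epsilon> > 0 \<Longrightarrow> \<forall>\<^sub>F n in sequentially. s n \<bullet> w \<le> B + \<epsilon>"
  shows "l \<bullet> w \<le> B"
proof (rule field_le_epsilon)
  fix e :: real assume e: "e > 0"
  show "l \<bullet> w \<le> B + e"
  proof (rule ccontr)
    assume "\<not> ?thesis"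
    hence "l \<in> {p. p \<bullet> (- w) < - (B + e)}" by simp
    hence "\<exists>\<^sub>F n in sequentially. s n \<in> {p. p \<bullet> (- w) < - (B + e)}"
      using assms(1) openin_weak_halfspace unfolding weak_cluster_point_def by blast
    from frequently_eventually_frequently[OF this assms(2)[OF e]]
    show False by (auto dest!: frequently_ex)
  qed
qed

lemma weak_cluster_point_tendsto:
  assumes cluster: "weak_cluster_point s l" and lim: "(\<lambda>n. s n \<bullet> w) \<longlonglongrightarrow> c"
  shows "l \<bullet> w = c"
proof (rule antisym)
  show "l \<bullet> w \<le> c"
  proof (rule weak_cluster_point_le[OF cluster])
    show "\<forall>\<^sub>F n in sequentially. s n \<bullet> w \<le> c + \<epsilon>" if "\<epsilon> > 0" for \<epsilon>
      using order_tendstoD(2)[OF lim, of "c + \<epsilon>"] that by (auto elim: eventually_mono)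
  qed
  have "l \<bullet> (- w) \<le> - c"
  proof (rule weak_cluster_point_le[OF cluster])
    show "\<forall>\<^sub>F n in sequentially. s n \<bullet> (- w) \<le> - c + \<epsilon>" if "\<epsilon> > 0" for \<epsilon>
      using order_tendstoD(1)[OF lim, of "c - \<epsilon>"] that by (auto elim: eventually_mono)
  qed
  thus "c \<le> l \<bullet> w" by simp
qed

text \<open>Tychonoff applied to the functionals \<open>\<lambda>w. s n \<bullet> w\<close>; a pointwise cluster point of them
  is again linear and bounded.\<close>

lemma bounded_has_weak_cluster:
  fixes s :: "nat \<Rightarrow> 'a::{real_inner,complete_space}"
  assumes bdd: "bounded (range s)" and F: "F \<noteq> bot"
  obtains l where "\<And>W. openin weak_topology W \<Longrightarrow> l \<in> W \<Longrightarrow> \<exists>\<^sub>F n in F. s n \<in> W"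
proof -
  obtain M where M: "\<And>n. norm (s n) \<le> M" using bdd by (auto simp: bounded_iff)
  let ?g = "\<lambda>n w. s n \<bullet> w"
  let ?C = "PiE UNIV (\<lambda>w::'a. {- (M * norm w) .. M * norm w})"
  have g_abs: "\<bar>?g n w\<bar> \<le> M * norm w" for n w
    using Cauchy_Schwarz_ineq2[of "s n" w] mult_right_mono[OF M[of n], of "norm w"] by simp
  have "compact ?C"
    using compactin_PiE[of "\<lambda>_. euclidean :: real topology" UNIV "\<lambda>w::'a. {- (M * norm w) .. M * norm w}"]
    by (simp add: euclidean_product_topology)
  moreover have "filtermap ?g F \<noteq> bot" using F by (simp add: filtermap_bot_iff)
  moreover have "eventually (\<lambda>f. f \<in> ?C) (filtermap ?g F)"
    using g_abs by (simp add: eventually_filtermap PiE_def Pi_def abs_le_iff minus_le_iff)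
  ultimately obtain \<phi> where \<phi>C: "\<phi> \<in> ?C" and \<phi>: "inf (nhds \<phi>) (filtermap ?g F) \<noteq> bot"
    unfolding compact_filter by blast
  have freq: "\<exists>\<^sub>F n in F. ?g n \<in> V" if "open V" "\<phi> \<in> V" for V
  proof (rule ccontr)
    assume "\<not> ?thesis"
    hence "eventually (\<lambda>f. f \<notin> V) (filtermap ?g F)"
      by (simp add: not_frequently eventually_filtermap)
    moreover have "eventually (\<lambda>f. f \<in> V) (nhds \<phi>)" using that by (rule eventually_nhds_in_open)
    ultimately have "eventually (\<lambda>_. False) (inf (nhds \<phi>) (filtermap ?g F))"
      unfolding eventually_inf by blast
    thus False using \<phi> by (simp add: trivial_limit_def)
  qed
  \<comment> \<open>Evaluations are continuous, so violating a linear relation is an open condition;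
    if \<open>\<phi>\<close> violated it, so would some functional \<open>?g n\<close>, which is
    linear.\<close>
  have eq: "\<phi> w = \<alpha> * \<phi> p + \<beta> * \<phi> q" if w: "w = \<alpha> *\<^sub>R p + \<beta> *\<^sub>R q" for w p q \<alpha> \<beta>
  proof (rule ccontr)
    assume neq: "\<not> ?thesis"
    let ?V = "{\<psi>. \<psi> w \<noteq> \<alpha> * \<psi> p + \<beta> * (\<psi> q :: real)}"
    have "open ?V"
      by (intro open_Collect_neq continuous_intros continuous_on_product_coordinates)
    then obtain n where "?g n \<in> ?V" using freq[of ?V] neq frequently_ex by blast
    thus False by (simp add: w inner_add_right)
  qed
  have "bounded_linear \<phi>"
  proof (rule bounded_linear_intro)
    show "\<phi> (p + q) = \<phi> p + \<phi> q" for p q using eq[of "p + q" 1 p 1 q] by simp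
    show "\<phi> (r *\<^sub>R p) = r *\<^sub>R \<phi> p" for r p using eq[of "r *\<^sub>R p" r p 0 p] by simp
    show "norm (\<phi> p) \<le> norm p * M" for p
      using \<phi>C by (auto simp: PiE_def Pi_def abs_le_iff minus_le_iff mult.commute)
  qed
  then obtain l where l: "\<And>w. \<phi> w = w \<bullet> l" using riesz_representation by blast
  hence \<phi>l: "\<phi> = (\<lambda>w. l \<bullet> w)" by (auto simp: inner_commute)
  show thesis
  proof
    fix W assume "openin weak_topology W" "l \<in> W"
    then obtain V where "open V" "W = (\<lambda>x w. x \<bullet> w) -` V" "\<phi> \<in> V"
      by (auto simp: weak_topology_def openin_pullback_topology \<phi>l)
    thus "\<exists>\<^sub>F n in F. s n \<in> W" using freq by auto
  qed
qed

text \<open>If one functional failed to converge, the indices where it stays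
  \<open>\<epsilon>\<close> away would carry a proper filter; a cluster point along that filter is
  one of \<open>s\<close>, hence \<open>l\<close>, which is absurd.\<close>

lemma unique_weak_cluster_point_limit:
  fixes s :: "nat \<Rightarrow> 'a::{real_inner,complete_space}"
  assumes bdd: "bounded (range s)" and uniq: "\<And>l'. weak_cluster_point s l' \<Longrightarrow> l' = l"
  shows "weakly_converges s l"
  unfolding weakly_converges_iff
proof (rule ccontr)
  assume "\<not> (\<forall>w. (\<lambda>n. s n \<bullet> w) \<longlonglongrightarrow> l \<bullet> w)"
  then obtain w \<epsilon> where \<epsilon>: "\<epsilon> > 0" and nev: "\<not> (\<forall>\<^sub>F n in sequentially. dist (s n \<bullet> w) (l \<bullet> w) < \<epsilon>)"
    by (auto simp: tendsto_iff)
  let ?A = "{n. \<not> dist (s n \<bullet> w) (l \<bullet> w) < \<epsilon>}"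
  let ?F = "inf sequentially (principal ?A)"
  have "?F \<noteq> bot"
    using nev by (simp add: trivial_limit_def eventually_inf_principal)
  then obtain l' where l': "\<And>W. openin weak_topology W \<Longrightarrow> l' \<in> W \<Longrightarrow> \<exists>\<^sub>F n in ?F. s n \<in> W"
    using bounded_has_weak_cluster[OF bdd] by blast
  have "weak_cluster_point s l'"
    unfolding weak_cluster_point_def using l' filter_leD[of ?F sequentially]
    by (metis frequently_def inf_le1)
  hence "l' = l" by (rule uniq)
  have "openin weak_topology ({p. p \<bullet> w < l \<bullet> w + \<epsilon>} \<inter> {p. p \<bullet> (- w) < l \<bullet> (- w) + \<epsilon>})"
    by (intro openin_Int openin_weak_halfspace)
  from l'[OF this] have "\<exists>\<^sub>F n in ?F. s n \<bullet> w < l \<bullet> w + \<epsilon> \<and> - (s n \<bullet> w) < \<epsilon> - l \<bullet> w"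
    using \<epsilon> by (simp add: \<open>l' = l\<close>)
  moreover have "\<forall>\<^sub>F n in ?F. n \<in> ?A" by (simp add: eventually_inf_principal)
  ultimately have "\<exists>\<^sub>F n in ?F. (s n \<bullet> w < l \<bullet> w + \<epsilon> \<and> - (s n \<bullet> w) < \<epsilon> - l \<bullet> w) \<and> n \<in> ?A"
    by (rule frequently_eventually_frequently)
  thus False by (auto simp: dist_real_def abs_less_iff frequently_const_iff dest!: frequently_ex)
qed

section \<open>Saddle points\<close>

lemma subdifferential_finite:
  assumes "proper_fun H" "s \<in> subdifferential H u"
  obtains r where "H u = ereal r"
proof -
  obtain w where "H w \<noteq> \<infinity>" using assms(1) by (auto simp: proper_fun_def)
  moreover have "H u + ereal (s \<bullet> (w - u)) \<le> H w" "H u \<noteq> -\<infinity>"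
    using assms by (auto simp: subdifferential_def proper_fun_def)
  ultimately show thesis using that by (cases "H u") auto
qed

lemma subdifferentialI:
  assumes "proper_fun H" "H u = ereal r" "\<And>w \<rho>. H w = ereal \<rho> \<Longrightarrow> s \<bullet> (w - u) \<le> \<rho> - r"
  shows "s \<in> subdifferential H u"
proof -
  have "H u + ereal (s \<bullet> (w - u)) \<le> H w" for w
    using assms(1,2) assms(3)[of w] by (cases "H w") (auto simp: proper_fun_def algebra_simps)
  thus ?thesis by (simp add: subdifferential_def)
qed

text \<open>The subgradient inequality at \<open>v t\<close> passes to the limit: lower
  semicontinuity controls \<open>H (v t)\<close> from below, and moving the base point to
  \<open>u\<close> costs a bounded sequence times a null sequence.\<close>

lemma subgradient_limsup:
  fixes H :: "'a::real_inner \<Rightarrow> ereal"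
  assumes lsc: "lsc_fun H" and v: "v \<longlonglongrightarrow> u" and s: "\<And>t. s t \<in> subdifferential H (v t)"
    and bdd: "bounded (range s)" and u: "H u = ereal r" and w: "H w = ereal \<rho>" and \<epsilon>: "\<epsilon> > 0"
  shows "\<forall>\<^sub>F t in sequentially. s t \<bullet> (w - u) \<le> \<rho> - r + \<epsilon>"
proof -
  have "\<forall>\<^sub>F q in nhds u. ereal (r - \<epsilon> / 2) < H q"
    using lsc u \<epsilon> by (simp add: lsc_fun_def)
  hence "\<forall>\<^sub>F t in sequentially. ereal (r - \<epsilon> / 2) < H (v t)"
    using v unfolding filterlim_iff by blast
  moreover have "(\<lambda>t. s t \<bullet> (v t - u)) \<longlonglongrightarrow> 0"
  proof -
    have "Bfun s sequentially" using bdd by (simp add: Bseq_eq_bounded)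
    moreover have "Zfun (\<lambda>t. v t - u) sequentially" using v by (simp add: tendsto_Zfun_iff)
    ultimately show ?thesis
      by (simp add: tendsto_Zfun_iff bounded_bilinear.Bfun_prod_Zfun[OF bounded_bilinear_inner])
  qed
  hence "\<forall>\<^sub>F t in sequentially. s t \<bullet> (v t - u) < \<epsilon> / 2"
    using \<epsilon> by (intro order_tendstoD(2)) auto
  ultimately show ?thesis
  proof eventually_elim
    case (elim t)
    have "H (v t) + ereal (s t \<bullet> (w - v t)) \<le> ereal \<rho>"
      using subdifferentialD[OF s[of t], of w] unfolding w .
    moreover have "s t \<bullet> (w - u) = s t \<bullet> (w - v t) + s t \<bullet> (v t - u)"
      by (simp add: inner_diff_right)
    ultimately show ?case using elim by (cases "H (v t)") auto
  qed
qed

lemma saddle_point_gradient: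
  "saddle_point gradf h K xs us \<Longrightarrow> gradf xs = - adjoint K us"
  by (simp add: saddle_point_def eq_neg_iff_add_eq_0)

text \<open>Turns first-order terms of \<open>f\<close> into the coupling terms of the
  Lagrangian.\<close>

lemma saddle_point_gradient_inner:
  fixes K :: "'x::{real_inner, complete_space} \<Rightarrow> 'u::real_inner"
  assumes K: "bounded_linear K" and saddle: "saddle_point gradf h K xs us"
  shows "gradf xs \<bullet> (p - xs) = K xs \<bullet> us - K p \<bullet> us"
  unfolding inner_adjoint[OF K] saddle_point_gradient[OF saddle]
  by (simp add: inner_diff_right inner_diff_left inner_commute)

text \<open>Fenchel-Young at \<open>xs\<close> plus the subgradient inequality at \<open>us\<close>
  bound the dual objective below; the \<open>u\<close> terms cancel, and the tangent inequality
  shows that the bound is attained at \<open>us\<close>.\<close>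

lemma saddle_point_dual_solution:
  fixes f :: "'x::{real_inner, complete_space} \<Rightarrow> real" and h :: "'u::{real_inner,complete_space} \<Rightarrow> ereal"
  assumes f: "convex_on UNIV f" and g: "\<And>p. GDERIV f p :> gradf p"
    and h: "proper_fun h" "lsc_fun h" "convex_fun h" and K: "bounded_linear K"
    and saddle: "saddle_point gradf h K xs us"
  shows "dual_solution f h K us"
proof -
  let ?f' = "conjugate (\<lambda>x. ereal (f x))"
  let ?b = "xs \<bullet> (- adjoint K us) - f xs"
  have sub: "K xs \<in> subdifferential (conjugate h) us"
    using saddle by (simp add: saddle_point_def)
  then obtain r where r: "conjugate h us = ereal r"
    using subdifferential_finite[OF proper_conjugate[OF h]] by blast
  have "?f' (- adjoint K us) \<le> ereal ?b"
  proof (rule conjugate_le)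
    show "ereal (w \<bullet> (- adjoint K us) - ?b) \<le> ereal (f w)" for w
      using convex_above_tangent[OF f g, of xs w]
      by (simp add: saddle_point_gradient_inner[OF K saddle] inner_adjoint[OF K])
  qed
  hence us: "?f' (- adjoint K us) + conjugate h us \<le> ereal (?b + r)"
    using add_right_mono[of _ "ereal ?b" "ereal r"] r by simp
  have "ereal (?b + r) \<le> ?f' (- adjoint K u) + conjugate h u" for u
  proof -
    have "ereal (?b + r) = ereal (xs \<bullet> (- adjoint K u) - f xs) + ereal (r + K xs \<bullet> (u - us))"
      by (simp add: inner_diff_right inner_adjoint[OF K])
    also have "\<dots> \<le> ?f' (- adjoint K u) + conjugate h u"
      using fenchel_young[of xs "- adjoint K u" "\<lambda>x. ereal (f x)"] sub r
      by (intro add_mono) (auto simp: subdifferential_def)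
    finally show ?thesis .
  qed
  from order_trans[OF us this] show ?thesis
    by (simp add: dual_solution_def minimizer_def is_arg_min_def not_less)
qed

text \<open>\<open>fenchel_moreau\<close> turns the dual subgradient relation into an upper bound
  for \<open>h (K xs)\<close>; Fenchel-Young and the tangent inequality bound every other objective
  value below by the same number.\<close>

lemma saddle_point_primal_solution:
  fixes f :: "'x::{real_inner, complete_space} \<Rightarrow> real" and h :: "'u::{real_inner,complete_space} \<Rightarrow> ereal"
  assumes f: "convex_on UNIV f" and g: "\<And>p. GDERIV f p :> gradf p"
    and h: "proper_fun h" "lsc_fun h" "convex_fun h" and K: "bounded_linear K"
    and saddle: "saddle_point gradf h K xs us"
  shows "primal_solution f h K xs"
proof -
  have sub: "K xs \<in> subdifferential (conjugate h) us"
    using saddle by (simp add: saddle_point_def)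
  then obtain r where r: "conjugate h us = ereal r"
    using subdifferential_finite[OF proper_conjugate[OF h]] by blast
  have "h (K xs) \<le> conjugate (conjugate h) (K xs)" by (rule fenchel_moreau[OF h])
  also have "\<dots> \<le> ereal (K xs \<bullet> us - r)"
  proof (rule conjugate_le)
    show "ereal (w \<bullet> K xs - (K xs \<bullet> us - r)) \<le> conjugate h w" for w
      using sub r by (simp add: subdifferential_def inner_diff_right inner_commute algebra_simps)
  qed
  finally have "h (K xs) \<le> ereal (K xs \<bullet> us - r)" .
  hence xs: "ereal (f xs) + h (K xs) \<le> ereal (f xs + K xs \<bullet> us - r)"
    by (cases "h (K xs)") auto
  have "ereal (f xs + K xs \<bullet> us - r) \<le> ereal (f p) + h (K p)" for p
  proof -
    have "f xs + K xs \<bullet> us \<le> f p + K p \<bullet> us"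
      using convex_above_tangent[OF f g, of xs p]
      by (simp add: saddle_point_gradient_inner[OF K saddle])
    moreover have "ereal (K p \<bullet> us) - h (K p) \<le> ereal r"
      using fenchel_young[of "K p" us h] r by simp
    ultimately show ?thesis by (cases "h (K p)") auto
  qed
  from order_trans[OF xs this] show ?thesis
    by (simp add: primal_solution_def minimizer_def is_arg_min_def not_less)
qed

text \<open>The gap is the sum of the Bregman distances of \<open>f\<close> and \<open>conjugate h\<close> to the
  saddle point.\<close>

lemma lagrangian_gap_ge_bregman:
  fixes f :: "'x::{real_inner, complete_space} \<Rightarrow> real" and h :: "'u::{real_inner,complete_space} \<Rightarrow> ereal"
  assumes h: "proper_fun h" "lsc_fun h" "convex_fun h" and K: "bounded_linear K"
    and saddle: "saddle_point gradf h K xs us"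
  shows "ereal (f p - f xs - gradf xs \<bullet> (p - xs)) \<le> lagrangian_gap f h K xs us p q"
proof -
  have sub: "K xs \<in> subdifferential (conjugate h) us"
    using saddle by (simp add: saddle_point_def)
  then obtain r where r: "conjugate h us = ereal r"
    using subdifferential_finite[OF proper_conjugate[OF h]] by blast
  have le: "ereal (r + K xs \<bullet> (q - us)) \<le> conjugate h q"
    using sub r by (auto simp: subdifferential_def)
  note g = saddle_point_gradient_inner[OF K saddle, of p]
  show ?thesis
    using le unfolding g
    by (cases "conjugate h q") (auto simp: lagrangian_gap_def lagrangian_def r inner_diff_right)
qed

text \<open>The gap sees \<open>xs\<close> only through \<open>f xs\<close> and \<open>K xs\<close>.
  With equal images the linear terms of both tangent inequalities vanish, so the values of
  \<open>f\<close> agree.\<close>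

lemma lagrangian_gap_cong:
  fixes f :: "'x::{real_inner, complete_space} \<Rightarrow> real"
  assumes f: "convex_on UNIV f" and g: "\<And>p. GDERIV f p :> gradf p" and K: "bounded_linear K"
    and saddle: "saddle_point gradf h K xs us" "saddle_point gradf h K xs' us" and eq: "K xs = K xs'"
  shows "lagrangian_gap f h K xs us = lagrangian_gap f h K xs' us"
proof -
  have "f xs = f xs'"
    using convex_above_tangent[OF f g, of xs xs'] convex_above_tangent[OF f g, of xs' xs] eq
    by (simp add: saddle[THEN saddle_point_gradient_inner[OF K]])
  thus ?thesis by (intro ext) (simp add: lagrangian_gap_def lagrangian_def eq)
qed

text \<open>Both energies are nonincreasing and nonnegative, hence convergent; in their difference
  \<open>G\<close> and \<open>R\<close> cancel and polarization leaves
  \<open>z t \<bullet> (p - q)\<close>.\<close>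

lemma lyapunov_difference_converges:
  fixes z :: "nat \<Rightarrow> 'x::real_inner" and G :: "nat \<Rightarrow> ereal"
  assumes \<gamma>: "\<gamma> > 0" and R: "\<And>t. R t \<ge> 0" and G: "\<And>t. 0 \<le> G t" "G \<longlonglongrightarrow> 0"
    and dec: "decseq (\<lambda>t. ereal (1 / (2 * \<gamma>) * (norm (z t - p))\<^sup>2) + ereal ((a t)\<^sup>2) * G t + ereal (R t))"
      "decseq (\<lambda>t. ereal (1 / (2 * \<gamma>) * (norm (z t - q))\<^sup>2) + ereal ((a t)\<^sup>2) * G t + ereal (R t))"
  shows "convergent (\<lambda>t. z t \<bullet> (p - q))"
proof -
  obtain T where T: "\<And>t. t \<ge> T \<Longrightarrow> G t < 1"
    using order_tendstoD(2)[OF G(2), of 1] by (auto simp: eventually_sequentially)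
  \<comment> \<open>\<open>real_of_ereal\<close> sends infinity to 0, so \<open>N\<close> agrees
    with the energies only from \<open>T\<close> on, where \<open>G\<close> is finite.\<close>
  define A where "A t = (a t)\<^sup>2 * real_of_ereal (G t) + R t" for t
  define N where "N c t = 1 / (2 * \<gamma>) * (norm (z t - c))\<^sup>2 + A t" for c t
  have GT: "G t = ereal (real_of_ereal (G t))" if "t \<ge> T" for t
    using T[OF that] G(1)[of t] by (cases "G t") auto
  have conv: "convergent (N c)"
    if "decseq (\<lambda>t. ereal (1 / (2 * \<gamma>) * (norm (z t - c))\<^sup>2) + ereal ((a t)\<^sup>2) * G t + ereal (R t))" for c
  proof -
    have N: "ereal (1 / (2 * \<gamma>) * (norm (z t - c))\<^sup>2) + ereal ((a t)\<^sup>2) * G t + ereal (R t) = ereal (N c t)"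
      if "t \<ge> T" for t
      by (subst GT[OF that]) (simp add: N_def A_def)
    have "decseq (\<lambda>t. N c (t + T))"
    proof (rule decseq_SucI)
      fix t show "N c (Suc t + T) \<le> N c (t + T)"
        using decseqD[OF that, of "t + T" "Suc t + T"] N[of "t + T"] N[of "Suc t + T"] by simp
    qed
    moreover have "0 \<le> N c t" for t
      using R[of t] \<gamma> G(1)[of t] by (simp add: N_def A_def real_of_ereal_pos)
    ultimately obtain L where "(\<lambda>t. N c (t + T)) \<longlonglongrightarrow> L" using decseq_convergent by blast
    thus ?thesis using LIMSEQ_offset convergentI by blast
  qed
  have "z t \<bullet> (p - q) = \<gamma> * (N q t - N p t) + (p \<bullet> p - q \<bullet> q) / 2" for t
    using \<gamma> unfolding N_def power2_norm_eq_inner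
    by (simp add: inner_diff_left inner_diff_right inner_commute field_simps)
  thus ?thesis
    using conv[OF dec(1)] conv[OF dec(2)]
    by (simp add: convergent_add convergent_diff convergent_mult convergent_const)
qed

text \<open>The rate in (a) uses \<open>1 / a (t+1)\<close>, the weight that forms
  \<open>y t\<close>; since \<open>a\<close> is not assumed monotone, the form with
  \<open>1 / a t\<close> is stated under a growth comparison. Assumption (v) starts at
  \<open>t+1\<close> because only proximal steps single out a subgradient.\<close>

theorem theorem3p15:
  fixes f :: "'x::{real_inner, complete_space} \<Rightarrow> real"
    and gradf :: "'x \<Rightarrow> 'x"
    and L\<^sub>f :: real
    and h :: "'u::{real_inner, complete_space} \<Rightarrow> ereal"
    and K :: "'x \<Rightarrow> 'u"
    and \<gamma> \<tau> :: real
    and a :: "nat \<Rightarrow> real"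
    and x y z zhat :: "nat \<Rightarrow> 'x"
    and u v :: "nat \<Rightarrow> 'u"
    and ustar :: 'u
  assumes f_convex: "convex_on UNIV f"
    and f_gradient: "\<And>p. GDERIV f p :> gradf p"
    and f_smooth: "L\<^sub>f > 0" "L\<^sub>f-lipschitz_on UNIV gradf"
    and h: "proper_fun h" "lsc_fun h" "convex_fun h"
    and K: "bounded_linear K" "K \<noteq> (\<lambda>_. 0)"
    and saddle_point_exists: "\<exists>xs us. saddle_point gradf h K xs us"
    and parameters: "\<gamma> > 0" "\<tau> > 0" "a 0 \<ge> 0" "\<And>t. t \<ge> 1 \<Longrightarrow> a t \<ge> 1"
    and init: "x 0 = z 0" "u 0 = v 0"
    and y_step: "\<And>t. y t = (1 - 1 / a (t+1)) *\<^sub>R x t + (1 / a (t+1)) *\<^sub>R z t"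
    and zhat_step: "\<And>t. zhat t =
          z t - (a (t+1) * \<gamma>) *\<^sub>R gradf (y t) - (a (t+1) * \<gamma>) *\<^sub>R adjoint K (v t)"
    and v_step: "\<And>t. v (t+1) =
          prox (\<lambda>w. ereal (\<tau> / a (t+1)) * conjugate h w) (v t + (\<tau> / a (t+1)) *\<^sub>R K (zhat t))"
    and z_step: "\<And>t. z (t+1) =
          z t - (a (t+1) * \<gamma>) *\<^sub>R gradf (y t) - (a (t+1) * \<gamma>) *\<^sub>R adjoint K (v (t+1))"
    and x_step: "\<And>t. x (t+1) = (1 - 1 / a (t+1)) *\<^sub>R x t + (1 / a (t+1)) *\<^sub>R z (t+1)"
    and u_step: "\<And>t. u (t+1) = (1 - 1 / a (t+1)) *\<^sub>R u t + (1 / a (t+1)) *\<^sub>R v (t+1)"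
    and i: "filterlim a at_top sequentially"
           "filterlim (\<lambda>n. \<Sum>t=1..n. 1 / a t) at_top sequentially"
    and ii: "dual_solution f h K ustar"
            "\<And>us. dual_solution f h K us \<Longrightarrow> us = ustar"
            "(\<lambda>t. norm (v t - ustar)) \<longlonglongrightarrow> 0"
    and iii: "bounded (range z)"
    and iv: "\<And>xs us. saddle_point gradf h K xs us \<Longrightarrow>
               (\<lambda>t. lagrangian_gap f h K xs us (x t) (u t)) \<longlonglongrightarrow> 0"
    and v: "(\<lambda>t. norm (K (z (t+1)) -
               prox_subgradient (conjugate h) (\<tau> / a (t+1)) (v (t+1))
                 (v t + (\<tau> / a (t+1)) *\<^sub>R K (zhat t)))) \<longlonglongrightarrow> 0"
  shows "
    ((\<lambda>t. norm (u t - ustar)) \<longlonglongrightarrow> 0 \<and>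
     (\<lambda>t. norm (y t - x t)) \<in> O(\<lambda>t. 1 / a (t+1)) \<and>
     (a \<in> O(\<lambda>t. a (t+1)) \<longrightarrow> (\<lambda>t. norm (y t - x t)) \<in> O(\<lambda>t. 1 / a t))) \<and>
    (\<forall>xs us. saddle_point gradf h K xs us \<longrightarrow>
       (\<forall>t. ereal ((norm (gradf (x t) + adjoint K us))\<^sup>2)
              \<le> ereal (2 * L\<^sub>f) * lagrangian_gap f h K xs us (x t) (u t)) \<and>
       (\<lambda>t. ereal (2 * L\<^sub>f) * lagrangian_gap f h K xs us (x t) (u t)) \<longlonglongrightarrow> 0) \<and>
    (bounded (range x) \<and> (\<forall>xi. weak_cluster_point x xi \<longrightarrow> primal_solution f h K xi)) \<and>
    (\<forall>zi. weak_cluster_point z zi \<longrightarrow> K zi \<in> subdifferential (conjugate h) ustar) \<and>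
    ((\<exists>R :: nat \<Rightarrow> real. (\<forall>t. R t \<ge> 0) \<and>
        (\<forall>xs us. saddle_point gradf h K xs us \<longrightarrow>
           decseq (\<lambda>t. ereal (1 / (2 * \<gamma>) * (norm (z t - xs))\<^sup>2)
                     + ereal ((a t)\<^sup>2) * lagrangian_gap f h K xs us (x t) (u t)
                     + ereal (R t)))) \<and>
     (\<forall>xs xs' us. saddle_point gradf h K xs us \<and> saddle_point gradf h K xs' us \<longrightarrow> K xs = K xs') \<longrightarrow>
     (\<exists>xs. primal_solution f h K xs \<and> weakly_converges x xs \<and> weakly_converges y xs))"
proof -
  let ?H = "conjugate h"
  let ?G = "\<lambda>xs us t. lagrangian_gap f h K xs us (x t) (u t)"
  note H = proper_conjugate[OF h] lsc_conjugate[OF h(1)]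
  note above = convex_above_tangent[OF f_convex f_gradient]
  note bregman = lagrangian_gap_ge_bregman[OF h K(1), where f = f]

  \<comment> \<open>The dual component of saddle points and the averaging weights\<close>
  have saddle_ustar: "us = ustar" if "saddle_point gradf h K xs us" for xs us
    using saddle_point_dual_solution[OF f_convex f_gradient h K(1) that] ii(2) by blast
  obtain xs0 where xs0: "saddle_point gradf h K xs0 ustar"
    using saddle_point_exists saddle_ustar by blast
  obtain r where r: "?H ustar = ereal r"
    using subdifferential_finite[OF H(1)] xs0 by (auto simp: saddle_point_def)
  \<comment> \<open>Shifted by one, since \<open>a 0\<close> may be 0 while later terms are at least
    1.\<close>
  define w where "w t = 1 / a (Suc t)" for t
  have w: "0 \<le> w t" "w t \<le> 1" for t
    using parameters(4)[of "Suc t"] by (simp_all add: w_def)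
  have w_div: "filterlim (\<lambda>n. \<Sum>t<n. w t) at_top sequentially"
  proof -
    have "(\<Sum>t<n. w t) = (\<Sum>t=1..n. 1 / a t)" for n
      unfolding w_def by (rule sum.reindex_bij_witness[of _ "\<lambda>t. t - 1" Suc]) auto
    thus ?thesis using i(2) by simp
  qed
  have x_Suc: "x (Suc t) = (1 - w t) *\<^sub>R x t + w t *\<^sub>R z (Suc t)" for t
    using x_step[of t] by (simp add: w_def)
  have y_diff: "y t - x t = w t *\<^sub>R (z t - x t)" for t
    using y_step[of t] by (simp add: w_def algebra_simps)

  \<comment> \<open>Boundedness of \<open>x\<close> and the distance from \<open>y\<close> to
    \<open>x\<close>\<close>
  obtain M where M: "\<And>t. norm (z t) \<le> M" using iii by (auto simp: bounded_iff)
  have x_le: "norm (x t) \<le> M" for t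
  proof (induction t)
    case (Suc t)
    have "norm (x (Suc t)) \<le> (1 - w t) * norm (x t) + w t * norm (z (Suc t))"
      unfolding x_Suc by (rule norm_triangle_le) (use w[of t] in simp)
    also have "\<dots> \<le> (1 - w t) * M + w t * M"
      using w[of t] Suc M by (intro add_mono mult_left_mono) auto
    finally show ?case by (simp add: algebra_simps)
  qed (simp add: init M)
  have x_bdd: "bounded (range x)" using x_le by (auto simp: bounded_iff)
  have y_le: "norm (y t - x t) \<le> 2 * M * w t" for t
  proof -
    have "norm (z t - x t) \<le> 2 * M" using norm_triangle_ineq4[of "z t" "x t"] M[of t] x_le[of t] by linarith
    thus ?thesis using w(1)[of t] by (simp add: y_diff mult_left_mono mult.commute)
  qed
  have a_Suc: "filterlim (\<lambda>t. a (Suc t)) at_top sequentially"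
    using i(1) by (simp add: filterlim_sequentially_Suc)
  have y_lim: "(\<lambda>t. y t - x t) \<longlonglongrightarrow> 0"
  proof (rule Lim_null_comparison)
    show "\<forall>\<^sub>F t in sequentially. norm (y t - x t) \<le> 2 * M * w t" using y_le by simp
    have "w \<longlonglongrightarrow> 0"
      using tendsto_inverse_0_at_top[OF a_Suc] unfolding w_def[abs_def] by (simp add: inverse_eq_divide)
    thus "(\<lambda>t. 2 * M * w t) \<longlonglongrightarrow> 0" by (rule tendsto_mult_right_zero)
  qed

  \<comment> \<open>Convergence of the dual averages\<close>
  have u_lim: "(\<lambda>t. norm (u t - ustar)) \<longlonglongrightarrow> 0"
  proof (rule tendstoI)
    fix e :: real assume e: "e > 0"
    have "\<forall>\<^sub>F t in sequentially. norm (u t - ustar) \<le> 0 + e / 2"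
    proof (rule relaxed_average_limsup[OF _ w w_div])
      show "norm (u (Suc t) - ustar) \<le> (1 - w t) * norm (u t - ustar) + w t * norm (v (Suc t) - ustar)" for t
      proof -
        have "u (Suc t) - ustar = (1 - w t) *\<^sub>R (u t - ustar) + w t *\<^sub>R (v (Suc t) - ustar)"
          using u_step[of t] by (simp add: w_def algebra_simps)
        thus ?thesis using w[of t] by (simp add: norm_triangle_le)
      qed
      show "\<forall>\<^sub>F t in sequentially. norm (v (Suc t) - ustar) \<le> 0 + \<delta>" if "\<delta> > 0" for \<delta>
        using order_tendstoD(2)[OF LIMSEQ_Suc[OF ii(3)], of \<delta>] that by (auto elim: eventually_mono)
    qed (use e in simp)
    thus "\<forall>\<^sub>F t in sequentially. dist (norm (u t - ustar)) 0 < e"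
      by eventually_elim (use e in simp)
  qed

  \<comment> \<open>The rate for the distance from \<open>y\<close> to \<open>x\<close>\<close>
  have y_O: "(\<lambda>t. norm (y t - x t)) \<in> O(\<lambda>t. 1 / a (t+1))"
    using y_le w(1) by (intro bigoI[of _ "2 * M"]) (simp add: w_def)
  have y_O': "(\<lambda>t. norm (y t - x t)) \<in> O(\<lambda>t. 1 / a t)" if a_O: "a \<in> O(\<lambda>t. a (t+1))"
  proof -
    have "(\<lambda>t. 1 / a (t+1)) \<in> O(\<lambda>t. 1 / a t)"
    proof -
      obtain c where c: "\<forall>\<^sub>F t in sequentially. norm (a t) \<le> c * norm (a (t+1))"
        using landau_o.bigE[OF a_O] by blast
      have "\<forall>\<^sub>F t in sequentially. norm (1 / a (t+1)) \<le> c * norm (1 / a t)"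
        using c eventually_ge_at_top[of 1]
      proof eventually_elim
        case (elim t)
        have "a t \<ge> 1" "a (t+1) \<ge> 1" using elim(2) parameters(4) by auto
        thus ?case using elim(1) by (simp add: field_simps)
      qed
      thus ?thesis by (rule bigoI)
    qed
    with y_O show ?thesis by (rule landau_o.big_trans)
  qed

  \<comment> \<open>The gradient residual and the Lagrangian gap\<close>
  have grad_bound: "ereal ((norm (gradf (x t) + adjoint K us))\<^sup>2) \<le> ereal (2 * L\<^sub>f) * ?G xs us t"
    if "saddle_point gradf h K xs us" for xs us t
  proof -
    have "ereal ((norm (gradf (x t) + adjoint K us))\<^sup>2)
        \<le> ereal (2 * L\<^sub>f) * ereal (f (x t) - f xs - gradf xs \<bullet> (x t - xs))"
      using gradient_difference_bound[OF f_convex f_gradient f_smooth, of "x t" xs]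
      by (simp add: saddle_point_gradient[OF that])
    also have "\<dots> \<le> ereal (2 * L\<^sub>f) * ?G xs us t"
      using bregman[OF that] f_smooth(1) by (intro ereal_mult_left_mono) auto
    finally show ?thesis .
  qed
  have gap_lim: "(\<lambda>t. ereal (2 * L\<^sub>f) * ?G xs us t) \<longlonglongrightarrow> 0"
    if "saddle_point gradf h K xs us" for xs us
    using tendsto_cmult_ereal[OF _ iv[OF that], of "ereal (2 * L\<^sub>f)"] by simp

  \<comment> \<open>Subgradients along the iteration and weak cluster points of
    \<open>z\<close>\<close>
  define s where "s t = prox_subgradient ?H (\<tau> / a (t+1)) (v (t+1)) (v t + (\<tau> / a (t+1)) *\<^sub>R K (zhat t))" for t
  have s_sub: "s t \<in> subdifferential ?H (v (Suc t))" for t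
    using prox_subgradient_conjugate[OF h _ v_step, of t] parameters(2) parameters(4)[of "t+1"]
    by (simp add: s_def)
  have Kz_s: "(\<lambda>t. K (z (Suc t)) - s t) \<longlonglongrightarrow> 0"
    using v by (simp add: s_def tendsto_norm_zero_iff)
  \<comment> \<open>\<open>s\<close> is written as a bounded sequence minus a convergent
    one.\<close>
  have "bounded (range (\<lambda>t. K (z (Suc t)) - (K (z (Suc t)) - s t)))"
  proof (rule bounded_minus_comp)
    have "bounded (K ` range z)" by (rule bounded_linear_image[OF iii K(1)])
    thus "bounded (range (\<lambda>t. K (z (Suc t))))" by (rule bounded_subset) auto
    show "bounded (range (\<lambda>t. K (z (Suc t)) - s t))"
      using Kz_s convergent_imp_bounded by blast
  qed
  hence s_bdd: "bounded (range s)" by simp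
  have v_Suc: "(\<lambda>t. v (Suc t)) \<longlonglongrightarrow> ustar"
    using LIMSEQ_Suc[OF ii(3)] by (simp add: LIM_zero_iff tendsto_norm_zero_iff)
  \<comment> \<open>Assumption (v) lets \<open>K (z (Suc t))\<close> replace \<open>s t\<close>;
    moving \<open>K\<close> to its adjoint tests \<open>z\<close> against a fixed vector, as weak
    cluster points require.\<close>
  have z_limsup: "\<forall>\<^sub>F t in sequentially. z (Suc t) \<bullet> adjoint K (q - ustar) \<le> \<rho> - r + \<epsilon>"
    if q: "?H q = ereal \<rho>" and \<epsilon>: "\<epsilon> > 0" for q \<rho> \<epsilon>
  proof -
    have "(\<lambda>t. (K (z (Suc t)) - s t) \<bullet> (q - ustar)) \<longlonglongrightarrow> 0 \<bullet> (q - ustar)"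
      by (intro tendsto_intros Kz_s)
    hence "\<forall>\<^sub>F t in sequentially. (K (z (Suc t)) - s t) \<bullet> (q - ustar) < \<epsilon> / 2"
      using \<epsilon> by (intro order_tendstoD(2)) auto
    moreover have "\<forall>\<^sub>F t in sequentially. s t \<bullet> (q - ustar) \<le> \<rho> - r + \<epsilon> / 2"
      using subgradient_limsup[OF H(2) v_Suc s_sub s_bdd r q, of "\<epsilon> / 2"] \<epsilon> by simp
    ultimately show ?thesis
      by eventually_elim (simp add: inner_adjoint[OF K(1), symmetric] inner_diff_left)
  qed
  have z_cluster: "K zi \<in> subdifferential ?H ustar" if "weak_cluster_point z zi" for zi
  proof (rule subdifferentialI[OF H(1) r])
    fix q \<rho> assume q: "?H q = ereal \<rho>"
    show "K zi \<bullet> (q - ustar) \<le> \<rho> - r"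
      unfolding inner_adjoint[OF K(1)]
      using z_limsup[OF q] by (intro weak_cluster_point_le[OF that]) (rule eventually_sequentially_Suc[THEN iffD1])
  qed

  \<comment> \<open>Weak cluster points of \<open>x\<close> are saddle points\<close>
  have x_cluster: "saddle_point gradf h K xi ustar" if xi: "weak_cluster_point x xi" for xi
  proof -
    have "K xi \<in> subdifferential ?H ustar"
    proof (rule subdifferentialI[OF H(1) r])
      fix q \<rho> assume q: "?H q = ereal \<rho>"
      show "K xi \<bullet> (q - ustar) \<le> \<rho> - r"
        unfolding inner_adjoint[OF K(1)]
      proof (rule weak_cluster_point_le[OF xi])
        fix \<epsilon> :: real assume "\<epsilon> > 0"
        thus "\<forall>\<^sub>F t in sequentially. x t \<bullet> adjoint K (q - ustar) \<le> \<rho> - r + \<epsilon>"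
          by (intro relaxed_average_limsup[OF _ w w_div z_limsup[OF q]]) (simp_all add: x_Suc inner_add_left)
      qed
    qed
    moreover have "gradf xi = gradf xs0"
    proof -
      let ?D = "f xi - f xs0 - gradf xs0 \<bullet> (xi - xs0)"
      let ?d = "gradf xi - gradf xs0"
      \<comment> \<open>The tangent inequality at \<open>xi\<close> bounds the Bregman distance of
        \<open>x t\<close> below by \<open>?D + ?d \<bullet> (x t - xi)\<close>. Since the gap
        bounds it above and vanishes, the cluster point property gives
        \<open>?D \<le> 0\<close>.\<close>
      have "xi \<bullet> ?d \<le> xi \<bullet> ?d - ?D"
      proof (rule weak_cluster_point_le[OF xi])
        fix \<epsilon> :: real assume "\<epsilon> > 0"
        hence "\<forall>\<^sub>F t in sequentially. ?G xs0 ustar t < ereal \<epsilon>"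
          by (intro order_tendstoD(2)[OF iv[OF xs0]]) simp
        thus "\<forall>\<^sub>F t in sequentially. x t \<bullet> ?d \<le> xi \<bullet> ?d - ?D + \<epsilon>"
        proof eventually_elim
          case (elim t)
          have "ereal (f (x t) - f xs0 - gradf xs0 \<bullet> (x t - xs0)) < ereal \<epsilon>"
            using bregman[OF xs0] elim by (rule le_less_trans)
          thus ?case using above[of xi "x t"]
            by (simp add: inner_diff_left inner_diff_right inner_commute)
        qed
      qed
      hence "(norm ?d)\<^sup>2 \<le> 0"
        using gradient_difference_bound[OF f_convex f_gradient f_smooth, of xi xs0] f_smooth(1)
        by (smt (verit) mult_nonneg_nonpos)
      thus ?thesis by simp
    qed
    ultimately show ?thesis using xs0 by (simp add: saddle_point_def)
  qed
  note primal = saddle_point_primal_solution[OF f_convex f_gradient h K(1)]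

  \<comment> \<open>Weak convergence of \<open>x\<close> and \<open>y\<close>\<close>
  have weak: "\<exists>xs. primal_solution f h K xs \<and> weakly_converges x xs \<and> weakly_converges y xs"
    if R: "\<And>t. R t \<ge> 0"
      and dec: "\<And>xs us. saddle_point gradf h K xs us \<Longrightarrow>
          decseq (\<lambda>t. ereal (1 / (2 * \<gamma>) * (norm (z t - xs))\<^sup>2)
                     + ereal ((a t)\<^sup>2) * ?G xs us t + ereal (R t))"
      and K_eq: "\<And>xs xs' us. saddle_point gradf h K xs us \<Longrightarrow> saddle_point gradf h K xs' us \<Longrightarrow> K xs = K xs'"
    for R :: "nat \<Rightarrow> real"
  proof -
    obtain xs where "\<And>W. openin weak_topology W \<Longrightarrow> xs \<in> W \<Longrightarrow> \<exists>\<^sub>F n in sequentially. x n \<in> W"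
      using bounded_has_weak_cluster[OF x_bdd sequentially_bot] by blast
    hence xs: "weak_cluster_point x xs" by (simp add: weak_cluster_point_def)
    have "xi = xs" if xi: "weak_cluster_point x xi" for xi
    proof -
      note sad = x_cluster[OF xi] x_cluster[OF xs]
      have eq: "?G xs ustar = ?G xi ustar"
        using lagrangian_gap_cong[OF f_convex f_gradient K(1) sad K_eq[OF sad]] by simp
      have "0 \<le> ?G xi ustar t" for t
      proof -
        have "0 \<le> f (x t) - f xi - gradf xi \<bullet> (x t - xi)" using above[of xi "x t"] by simp
        thus ?thesis using order_trans[OF _ bregman[OF sad(1)]] by simp
      qed
      hence "convergent (\<lambda>t. z t \<bullet> (xi - xs))"
        \<comment> \<open>Rewriting with \<open>eq\<close> gives both Lyapunov functions the same
          gap sequence.\<close>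
        using dec[OF sad(2)] unfolding fun_cong[OF eq]
        by (intro lyapunov_difference_converges[OF parameters(1) R _ iv[OF sad(1)] dec[OF sad(1)]])
      then obtain c where "(\<lambda>t. z t \<bullet> (xi - xs)) \<longlonglongrightarrow> c" by (auto simp: convergent_def)
      \<comment> \<open>The shift matches the averaging rule, in which \<open>x (Suc t)\<close> uses
        \<open>z (Suc t)\<close>.\<close>
      hence "(\<lambda>t. z (Suc t) \<bullet> (xi - xs)) \<longlonglongrightarrow> c" by (rule LIMSEQ_Suc)
      hence "(\<lambda>t. x t \<bullet> (xi - xs)) \<longlonglongrightarrow> c"
        by (rule relaxed_average_tendsto[OF _ w w_div, rotated]) (simp add: x_Suc inner_add_left)
      hence "xi \<bullet> (xi - xs) = xs \<bullet> (xi - xs)"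
        using weak_cluster_point_tendsto xi xs by metis
      hence "(xi - xs) \<bullet> (xi - xs) = 0" by (simp add: inner_diff_left)
      thus ?thesis by simp
    qed
    hence "weakly_converges x xs" by (rule unique_weak_cluster_point_limit[OF x_bdd])
    moreover have "weakly_converges y xs"
      unfolding weakly_converges_iff
    proof
      fix q
      have "(\<lambda>t. x t \<bullet> q) \<longlonglongrightarrow> xs \<bullet> q"
        using \<open>weakly_converges x xs\<close> by (simp add: weakly_converges_iff)
      moreover have "(\<lambda>t. (y t - x t) \<bullet> q) \<longlonglongrightarrow> 0 \<bullet> q"
        by (intro tendsto_inner y_lim tendsto_const)
      ultimately have "(\<lambda>t. x t \<bullet> q + (y t - x t) \<bullet> q) \<longlonglongrightarrow> xs \<bullet> q + 0 \<bullet> q"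
        by (rule tendsto_add)
      thus "(\<lambda>t. y t \<bullet> q) \<longlonglongrightarrow> xs \<bullet> q" by (simp add: inner_diff_left)
    qed
    ultimately show ?thesis using primal[OF x_cluster[OF xs]] by blast
  qed

  show ?thesis
  proof (intro conjI allI impI)
    fix xi assume "weak_cluster_point x xi"
    thus "primal_solution f h K xi" by (rule primal[OF x_cluster])
  next
    assume prems: "(\<exists>R :: nat \<Rightarrow> real. (\<forall>t. R t \<ge> 0) \<and>
        (\<forall>xs us. saddle_point gradf h K xs us \<longrightarrow>
           decseq (\<lambda>t. ereal (1 / (2 * \<gamma>) * (norm (z t - xs))\<^sup>2)
                     + ereal ((a t)\<^sup>2) * ?G xs us t + ereal (R t)))) \<and>
     (\<forall>xs xs' us. saddle_point gradf h K xs us \<and> saddle_point gradf h K xs' us \<longrightarrow> K xs = K xs')"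
    then obtain R where "\<forall>t. (0::real) \<le> R t" "\<forall>xs us. saddle_point gradf h K xs us \<longrightarrow>
           decseq (\<lambda>t. ereal (1 / (2 * \<gamma>) * (norm (z t - xs))\<^sup>2)
                     + ereal ((a t)\<^sup>2) * ?G xs us t + ereal (R t))"
      by (elim conjE exE)
    with prems show "\<exists>xs. primal_solution f h K xs \<and> weakly_converges x xs \<and> weakly_converges y xs"
      by (intro weak[of R]) (simp, simp, blast)
  qed (fact u_lim y_O y_O' grad_bound gap_lim x_bdd z_cluster)+
qed

end
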